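(* Let $K$ be a field, $S=K[x_1,\ldots,x_n]$, $I$ a monomial ideal of $S$, and let $u_1,\ldots,u_r$ be monomials in $S$ forming a filter-regular sequence on $S/I$. Then $S/I$ is pretty clean if and only if $S/(I,u_1,\ldots,u_r)$ is pretty clean.
   Context: $S=K[x_1,\ldots,x_n]$ carries its standard $\mathbb{Z}^n$-grading (``multigrading''), and $\mathfrak{m}=(x_1,\ldots,x_n)$. Filter-regular sequence: for a finitely generated multigraded $S$-module $M$, a non-unit monomial $u\in S$ is a filter-regular element on $M$ if $u\notin\bigcup_{\mathfrak{p}\in \operatorname{Ass}_S M\setminus\{\mathfrak{m}\}}\mathfrak{p}$. A sequence $u_1,\ldots,u_r$ of non-unit monomials in $S$ is a filter-regular sequence on $M$ if for each $1\le i\le r$, $u_i$ is a filter-regular element on $M/(u_1,\ldots,u_{i-1})M$. Pretty clean: a (multigraded) prime filtration of a finitely generated multigraded $S$-module $M$ is a finite filtration $\mathcal{F}: 0=M_0\subset M_1\subset\cdots\subset M_r=M$ by multigraded submodules such that there are multigraded isomorphisms $M_i/M_{i-1}\cong S/\mathfrak{p}_i(-a_i)$ with $a_i\in\mathbb{Z}^n$ and $\mathfrak{p}_i$ a multigraded prime ideal of $S$. It is called pretty clean if for all $i<j$ with $\mathfrak{p}_i\subseteq\mathfrak{p}_j$ one has $\mathfrak{p}_i=\mathfrak{p}_j$. The module $M$ is pretty clean if it admits a pretty clean filtration. *)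

theory Defs
  imports "HOL-Algebra.Algebra" "HOL-Algebra.Algebraic_Closure_Type" "HOL-Library.Poly_Mapping"
begin

definition quotient_smult ::
  "('a, 'm, 'z) module_scheme \<Rightarrow> 'm set \<Rightarrow> 'a \<Rightarrow> 'm set \<Rightarrow> 'm set"
  where "quotient_smult M N s C = (\<Union>x\<in>C. N +>\<^bsub>M\<^esub> (s \<odot>\<^bsub>M\<^esub> x))"

text \<open>The submodule \<open>J M\<close> generated by all products of elements of \<open>J\<close> and \<open>M\<close>.\<close>

definition ideal_smult ::
  "('a, 'r) ring_scheme \<Rightarrow> 'a set \<Rightarrow> ('a, 'm, 'z) module_scheme \<Rightarrow> 'm set"
  where "ideal_smult R J M =
    \<Inter> {N. submodule N R M \<and> (\<forall>s\<in>J. \<forall>x\<in>carrier M. s \<odot>\<^bsub>M\<^esub> x \<in> N)}"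

definition annihilator ::
  "('a, 'r) ring_scheme \<Rightarrow> ('a, 'm, 'z) module_scheme \<Rightarrow> 'm \<Rightarrow> 'a set"
  where "annihilator R M x = {s \<in> carrier R. s \<odot>\<^bsub>M\<^esub> x = \<zero>\<^bsub>M\<^esub>}"

definition associated_primes ::
  "('a, 'r) ring_scheme \<Rightarrow> ('a, 'm, 'z) module_scheme \<Rightarrow> 'a set set"
  where "associated_primes R M =
    {P. primeideal P R \<and> (\<exists>x\<in>carrier M. P = annihilator R M x)}"

definition linear_maps ::
  "('a, 'r) ring_scheme \<Rightarrow> ('a, 'm, 'y) module_scheme \<Rightarrow> ('a, 'l, 'z) module_scheme
    \<Rightarrow> ('m \<Rightarrow> 'l) set"
  where "linear_maps R M N =
    {f \<in> carrier M \<rightarrow> carrier N.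
      (\<forall>x\<in>carrier M. \<forall>y\<in>carrier M. f (x \<oplus>\<^bsub>M\<^esub> y) = f x \<oplus>\<^bsub>N\<^esub> f y) \<and>
      (\<forall>s\<in>carrier R. \<forall>x\<in>carrier M. f (s \<odot>\<^bsub>M\<^esub> x) = s \<odot>\<^bsub>N\<^esub> f x)}"


text \<open>
  The polynomial ring \<open>S = K[x\<^sub>1, \<dots>, x\<^sub>n]\<close>: the variables are indexed by a finite
  type \<open>'n\<close>, a monomial is its exponent vector, and a polynomial maps exponent vectors to
  coefficients.
\<close>

type_synonym ('n, 'k) mpoly = "('n \<Rightarrow>\<^sub>0 nat) \<Rightarrow>\<^sub>0 'k"

abbreviation mpoly_ring :: "('n::finite, 'k::field) mpoly ring"
  where "mpoly_ring \<equiv> ring_of_type_algebra"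

definition var :: "'n \<Rightarrow> ('n::finite, 'k::field) mpoly"
  where "var i = Poly_Mapping.single (Poly_Mapping.single i 1) 1"

definition monomial :: "('n::finite, 'k::field) mpoly \<Rightarrow> bool"
  where "monomial u \<longleftrightarrow> (\<exists>e. u = Poly_Mapping.single e 1)"

definition monomial_ideal :: "('n::finite, 'k::field) mpoly set \<Rightarrow> bool"
  where "monomial_ideal I \<longleftrightarrow> (\<exists>A \<subseteq> Collect monomial. I = Idl\<^bsub>mpoly_ring\<^esub> A)"

definition max_ideal :: "('n::finite, 'k::field) mpoly set"
  where "max_ideal = Idl\<^bsub>mpoly_ring\<^esub> (range var)"


text \<open>
  Multigraded modules: \<open>component M a\<close> is the homogeneous component of \<open>M\<close> of degree
  \<open>a \<in> \<int>\<^sup>n\<close>.  The fields \<open>mult\<close> and \<open>one\<close> that library modules inherit from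
  rings play no role.
\<close>

record ('a, 'm, 'n) mgmodule = "('a, 'm) module" +
  component :: "('n \<Rightarrow> int) \<Rightarrow> 'm set"

definition poly_module ::
  "(('n::finite, 'k::field) mpoly, ('n, 'k) mpoly, 'n) mgmodule"
  where "poly_module =
    \<lparr> carrier = UNIV, monoid.mult = (*), one = 1, ring.zero = 0, add = (+), module.smult = (*),
      component = (\<lambda>a. {p. \<forall>e\<in>Poly_Mapping.keys p. \<forall>i. int (Poly_Mapping.lookup e i) = a i}) \<rparr>"

locale multigraded_module =
  Module.module "mpoly_ring :: ('n::finite, 'k::field) mpoly ring" M
  for M :: "(('n::finite, 'k::field) mpoly, 'm, 'n) mgmodule" (structure) +
  assumes component_subgroup: "subgroup (component M a) (add_monoid M)"
    and direct_sum: "x \<in> carrier M \<Longrightarrow>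
      \<exists>!f. (\<forall>a. f a \<in> component M a) \<and> finite {a. f a \<noteq> \<zero>\<^bsub>M\<^esub>} \<and>
        x = (\<Oplus>\<^bsub>M\<^esub> a\<in>{a. f a \<noteq> \<zero>\<^bsub>M\<^esub>}. f a)"
    and smult_component:
      "\<lbrakk>s \<in> component poly_module b; x \<in> component M a\<rbrakk>
        \<Longrightarrow> s \<odot>\<^bsub>M\<^esub> x \<in> component M (\<lambda>i. b i + a i)"

definition restrict_module :: "('a, 'm, 'n) mgmodule \<Rightarrow> 'm set \<Rightarrow> ('a, 'm, 'n) mgmodule"
  where "restrict_module M N = M\<lparr>carrier := N, component := (\<lambda>a. component M a \<inter> N)\<rparr>"

definition quotient_module ::
  "('a, 'm, 'n) mgmodule \<Rightarrow> 'm set \<Rightarrow> ('a, 'm set, 'n) mgmodule"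
  where "quotient_module M N =
    \<lparr> carrier = a_rcosets\<^bsub>M\<^esub> N, monoid.mult = undefined, one = undefined,
      ring.zero = N, add = set_add M, module.smult = quotient_smult M N,
      component = (\<lambda>a. (\<lambda>x. N +>\<^bsub>M\<^esub> x) ` component M a) \<rparr>"

text \<open>The shifted module \<open>M(a)\<close>, with \<open>M(a)\<^sub>b = M\<^bsub>a+b\<^esub>\<close>.\<close>

definition shift_module :: "('a, 'm, 'n) mgmodule \<Rightarrow> ('n \<Rightarrow> int) \<Rightarrow> ('a, 'm, 'n) mgmodule"
  where "shift_module M a = M\<lparr>component := (\<lambda>b. component M (\<lambda>i. a i + b i))\<rparr>"

definition multigraded_submodule ::
  "'m set \<Rightarrow> (('n::finite, 'k::field) mpoly, 'm, 'n) mgmodule \<Rightarrow> bool"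
  where "multigraded_submodule N M \<longleftrightarrow>
    submodule N mpoly_ring M \<and> multigraded_module (restrict_module M N)"

definition multigraded_prime :: "('n::finite, 'k::field) mpoly set \<Rightarrow> bool"
  where "multigraded_prime P \<longleftrightarrow> primeideal P mpoly_ring \<and> multigraded_submodule P poly_module"

definition multigraded_isomorphic ::
  "(('n::finite, 'k::field) mpoly, 'm, 'n) mgmodule \<Rightarrow> (('n, 'k) mpoly, 'l, 'n) mgmodule \<Rightarrow> bool"
  where "multigraded_isomorphic M N \<longleftrightarrow>
    (\<exists>f \<in> linear_maps mpoly_ring M N. bij_betw f (carrier M) (carrier N) \<and>
      (\<forall>a. f ` component M a = component N a))"


definition filter_regular_element ::
  "('n::finite, 'k::field) mpoly \<Rightarrow> (('n, 'k) mpoly, 'm, 'n) mgmodule \<Rightarrow> bool"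
  where "filter_regular_element u M \<longleftrightarrow>
    monomial u \<and> u \<notin> Units mpoly_ring \<and> u \<notin> \<Union> (associated_primes mpoly_ring M - {max_ideal})"

text \<open>
  Lists are indexed from 0: the entry \<open>us ! i\<close> is tested on the quotient by the ideal
  generated by the entries before it.
\<close>

definition filter_regular_sequence ::
  "('n::finite, 'k::field) mpoly list \<Rightarrow> (('n, 'k) mpoly, 'm, 'n) mgmodule \<Rightarrow> bool"
  where "filter_regular_sequence us M \<longleftrightarrow>
    (\<forall>i<length us. filter_regular_element (us ! i)
      (quotient_module M (ideal_smult mpoly_ring (Idl\<^bsub>mpoly_ring\<^esub> (set (take i us))) M)))"

definition prime_filtration ::
  "(('n::finite, 'k::field) mpoly, 'm, 'n) mgmodule \<Rightarrow> nat \<Rightarrow> (nat \<Rightarrow> 'm set)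
    \<Rightarrow> (nat \<Rightarrow> ('n, 'k) mpoly set) \<Rightarrow> (nat \<Rightarrow> 'n \<Rightarrow> int) \<Rightarrow> bool"
  where "prime_filtration M r F P a \<longleftrightarrow>
    F 0 = {\<zero>\<^bsub>M\<^esub>} \<and> F r = carrier M \<and> (\<forall>i\<in>{0..r}. multigraded_submodule (F i) M) \<and>
    (\<forall>i\<in>{1..r}. F (i - 1) \<subset> F i \<and> multigraded_prime (P i) \<and>
      multigraded_isomorphic
        (quotient_module (restrict_module M (F i)) (F (i - 1)))
        (shift_module (quotient_module poly_module (P i)) (\<lambda>j. - a i j)))"

definition pretty_clean ::
  "(('n::finite, 'k::field) mpoly, 'm, 'n) mgmodule \<Rightarrow> bool"
  where "pretty_clean M \<longleftrightarrow>
    (\<exists>r F P a. prime_filtration M r F P a \<and>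
      (\<forall>i\<in>{1..r}. \<forall>j\<in>{1..r}. i < j \<and> P i \<subseteq> P j \<longrightarrow> P i = P j))"

end

theory Submission
  imports Defs
begin

text \<open>
  Everything about \<open>S/I\<close> for a monomial ideal \<open>I\<close> can be read off from the set \<open>A\<close> of exponent
  vectors of the monomials in \<open>I\<close>, which is closed upwards.  A factor \<open>S/P(-w)\<close> with
  \<open>P = (x\<^sub>i : i \<in> F)\<close> in a multigraded prime filtration contributes exactly the monomials in the
  cell \<open>w + {e : e\<^sub>i = 0 for i \<in> F}\<close>.  So \<open>S/I\<close> is pretty clean iff \<open>A\<close> can be enlarged to the
  set of all exponents by successively adding disjoint cells, keeping the set upward closed, such
  that an \<open>F\<close> is never properly contained in a later one (\<open>pretty_clean_residue_module_iff\<close>).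
  The theorem becomes a statement about adjoining \<open>{u..}\<close> to an up-closed set.

  The case of one monomial \<open>u\<close> rests on three facts.

  (1) Adding or removing finitely many monomials does not matter
  (\<open>cell_pretty_clean_finite_change\<close>): a point is a cell with \<open>F\<close> the set of all variables,
  prettiness puts such cells at the beginning, and together they fill the part of finite length.
  Hence \<open>A\<close> may be replaced by its saturation \<open>J\<close>, which differs from \<open>A\<close> by finitely many
  points by Dickson's lemma.

  (2) If \<open>u\<close> is filter-regular, then the variables dividing \<open>u\<close> do not matter for membership in
  \<open>J\<close> (\<open>saturation_independent_of\<close>): otherwise a maximal colon ideal of the
  saturation would give an associated prime of \<open>S/I\<close> that contains a variable of \<open>u\<close> and is not
  the maximal ideal (\<open>prime_colon_of_unsaturated_step\<close>).

  (3) For a set \<open>J\<close> that is independent of the variables in \<open>u\<close>, cell filtrations of \<open>J\<close> and of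
  \<open>J \<union> {u..}\<close> can be converted into each other (\<open>cell_pretty_clean_adjoin\<close>).  Fixing the
  exponents of those variables turns a filtration of either set into one of \<open>J\<close>.  With large
  values all surviving cells have \<open>F\<close> disjoint from the variables of \<open>u\<close>; cutting each of them
  along \<open>u\<close>, one variable at a time, gives a filtration of \<open>J \<union> {u..}\<close>.  In the other direction
  the exponent of one variable \<open>v\<close> is fixed just below its exponent in \<open>u\<close>, and all surviving
  \<open>F\<close> contain \<open>v\<close> and no other variable of \<open>u\<close>, so that inclusions between them are not
  changed by dropping \<open>v\<close>.
\<close>

section \<open>Filtrations by cells\<close>

definition up_closed :: "('n \<Rightarrow> nat) set \<Rightarrow> bool"
  where "up_closed A \<longleftrightarrow> (\<forall>x\<in>A. \<forall>y. x \<le> y \<longrightarrow> y \<in> A)"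

definition cell :: "('n \<Rightarrow> nat) \<Rightarrow> 'n set \<Rightarrow> ('n \<Rightarrow> nat) set"
  where "cell w F = {z. w \<le> z \<and> (\<forall>i\<in>F. z i = w i)}"

text \<open>
  The combinatorial form of a prime filtration from \<open>A\<close> to \<open>B\<close>: the ideal with exponents \<open>A\<close>
  grows by one shifted monomial prime quotient at a time.
\<close>

fun cell_filtration ::
  "('n \<Rightarrow> nat) set \<Rightarrow> (('n \<Rightarrow> nat) \<times> 'n set) list \<Rightarrow> ('n \<Rightarrow> nat) set \<Rightarrow> bool" where
  "cell_filtration A [] B \<longleftrightarrow> A = B"
| "cell_filtration A ((w, F) # c) B \<longleftrightarrow>
    cell w F \<inter> A = {} \<and> up_closed (A \<union> cell w F) \<and> cell_filtration (A \<union> cell w F) c B"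

definition pretty :: "('a \<times> 'n set) list \<Rightarrow> bool"
  where "pretty c \<longleftrightarrow> sorted_wrt (\<lambda>F G. F \<subseteq> G \<longrightarrow> F = G) (map snd c)"

definition cell_pretty_clean :: "('n \<Rightarrow> nat) set \<Rightarrow> bool"
  where "cell_pretty_clean A \<longleftrightarrow> (\<exists>c. cell_filtration A c UNIV \<and> pretty c)"

lemma up_closedD: "up_closed A \<Longrightarrow> x \<in> A \<Longrightarrow> x \<le> y \<Longrightarrow> y \<in> A"
  by (auto simp: up_closed_def)

lemma up_closed_Un: "up_closed A \<Longrightarrow> up_closed B \<Longrightarrow> up_closed (A \<union> B)"
  by (auto simp: up_closed_def)

lemma up_closed_atLeast: "up_closed {u..}"
  by (auto simp: up_closed_def)

lemma base_in_cell: "w \<in> cell w F"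
  by (simp add: cell_def)

lemma cell_UNIV: "cell w UNIV = {w}"
  by (auto simp: cell_def)

lemma cell_filtration_append:
  "cell_filtration A (c @ d) B \<longleftrightarrow> (\<exists>C. cell_filtration A c C \<and> cell_filtration C d B)"
  by (induction c arbitrary: A) auto

lemma cell_filtration_union:
  "cell_filtration A c B \<Longrightarrow> B = A \<union> (\<Union>(w, F)\<in>set c. cell w F)"
proof (induction c arbitrary: A)
  case (Cons x c)
  obtain w F where x: "x = (w, F)" by fastforce
  have "B = (A \<union> cell w F) \<union> (\<Union>(w, F)\<in>set c. cell w F)"
    using Cons.prems x by (intro Cons.IH) simp
  then show ?case by (simp add: x Un_assoc)
qed simp

lemma cell_filtration_disjoint:
  "cell_filtration A c B \<Longrightarrow> (w, F) \<in> set c \<Longrightarrow> cell w F \<inter> A = {}"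
proof (induction c arbitrary: A)
  case (Cons x c)
  obtain w' F' where x: "x = (w', F')" by fastforce
  show ?case
  proof (cases "(w, F) = x")
    case True then show ?thesis using Cons.prems x by auto
  next
    case False
    then have "cell w F \<inter> (A \<union> cell w' F') = {}"
      using Cons x by (intro Cons.IH) auto
    then show ?thesis by auto
  qed
qed simp

lemma pretty_append:
  "pretty (c @ d) \<longleftrightarrow> pretty c \<and> pretty d \<and>
    (\<forall>F\<in>snd ` set c. \<forall>G\<in>snd ` set d. F \<subseteq> G \<longrightarrow> F = G)"
  by (auto simp: pretty_def sorted_wrt_append)

lemma pretty_Cons:
  "pretty (x # d) \<longleftrightarrow> pretty d \<and> (\<forall>G\<in>snd ` set d. snd x \<subseteq> G \<longrightarrow> snd x = G)"
  by (auto simp: pretty_def)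

section \<open>Dickson's lemma\<close>

text \<open>
  A monotone subsequence exists for every real sequence; over the naturals a decreasing one becomes
  constant at its minimum.
\<close>

lemma nat_seq_mono_subseq:
  fixes g :: "nat \<Rightarrow> nat"
  shows "\<exists>q :: nat \<Rightarrow> nat. strict_mono q \<and> mono (g \<circ> q)"
proof -
  obtain q where q: "strict_mono q" "monoseq (\<lambda>n. g (q n))"
    using seq_monosub[of g] by auto
  show ?thesis
  proof (cases "incseq (\<lambda>n. g (q n))")
    case True then show ?thesis using q(1) by (intro exI[of _ q]) (simp add: o_def)
  next
    case False
    then have dec: "decseq (\<lambda>n. g (q n))" using q(2) by (simp add: monoseq_iff)
    obtain N where N: "\<And>n. g (q N) \<le> g (q n)"
      using ex_has_least_nat[of "\<lambda>_. True" _ "\<lambda>n. g (q n)"] by auto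
    have "g (q (n + N)) = g (q N)" for n
      using N[of "n + N"] decseqD[OF dec, of N "n + N"] by simp
    then have "mono (g \<circ> (\<lambda>n. q (n + N)))" by (auto simp: mono_def)
    moreover have "strict_mono (\<lambda>n. q (n + N))"
      using q(1) by (auto simp: strict_mono_def)
    ultimately show ?thesis by blast
  qed
qed

text \<open>
  Monotone subsequences are extracted one coordinate after the other.
\<close>

lemma dickson:
  fixes f :: "nat \<Rightarrow> 'n::finite \<Rightarrow> nat"
  shows "\<exists>r :: nat \<Rightarrow> nat. strict_mono r \<and> mono (f \<circ> r)"
proof -
  have "\<exists>r :: nat \<Rightarrow> nat. strict_mono r \<and> (\<forall>s\<in>S. mono (\<lambda>k. f (r k) s))" if "finite S" for S
    using that
  proof induction
    case empty
    show ?case by (intro exI[of _ id]) (auto simp: strict_mono_def)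
  next
    case (insert s S)
    then obtain r :: "nat \<Rightarrow> nat" where r: "strict_mono r" "\<And>t. t \<in> S \<Longrightarrow> mono (\<lambda>k. f (r k) t)" by blast
    obtain q :: "nat \<Rightarrow> nat" where q: "strict_mono q" "mono ((\<lambda>k. f (r k) s) \<circ> q)"
      using nat_seq_mono_subseq[of "\<lambda>k. f (r k) s"] by blast
    have mq: "mono q" using q(1) by (rule strict_mono_mono)
    have "mono (\<lambda>k. f ((r \<circ> q) k) t)" if "t \<in> insert s S" for t
      using that r(2)[of t] q(2) mq by (auto simp: mono_def o_def)
    moreover have "strict_mono (r \<circ> q)" using r(1) q(1) by (rule strict_mono_o)
    ultimately show ?case by blast
  qed
  from this[of UNIV] obtain r :: "nat \<Rightarrow> nat" where "strict_mono r" "\<And>s. mono (\<lambda>k. f (r k) s)" by auto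
  then show ?thesis by (intro exI[of _ r]) (auto simp: mono_def le_fun_def)
qed

text \<open>
  An infinite set would contain an infinite ascending sequence, and its first element would have
  infinitely many elements above it.
\<close>

lemma finite_if_finitely_many_above:
  fixes D :: "('n::finite \<Rightarrow> nat) set"
  assumes "\<And>w. w \<in> D \<Longrightarrow> finite ({w..} \<inter> D)"
  shows "finite D"
proof (rule ccontr)
  assume "infinite D"
  then obtain f :: "nat \<Rightarrow> 'n \<Rightarrow> nat" where f: "inj f" "range f \<subseteq> D"
    using infinite_countable_subset by blast
  obtain r :: "nat \<Rightarrow> nat" where r: "strict_mono r" "mono (f \<circ> r)" using dickson by blast
  have "range (f \<circ> r) \<subseteq> {f (r 0)..} \<inter> D"
    using f(2) r(2) by (auto simp: mono_def)
  moreover have "infinite (range (f \<circ> r))"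
    using inj_compose[OF f(1) strict_mono_imp_inj_on[OF r(1)]] by (rule range_inj_infinite)
  ultimately have "infinite ({f (r 0)..} \<inter> D)" using finite_subset by blast
  moreover have "f (r 0) \<in> D" using f(2) by blast
  ultimately show False using assms by blast
qed

text \<open>
  Noetherianity for monomial ideals: in an infinite ascending chain, an element that is new at one
  stage could never lie above one that was new earlier, against Dickson's lemma.
\<close>

lemma wf_up_closed_superset:
  "wf {(B :: ('n::finite \<Rightarrow> nat) set, A). up_closed A \<and> up_closed B \<and> A \<subset> B}"
  unfolding wf_iff_no_infinite_down_chain
proof safe
  fix U :: "nat \<Rightarrow> ('n \<Rightarrow> nat) set"
  assume U: "\<forall>i. (U (Suc i), U i) \<in> {(B, A). up_closed A \<and> up_closed B \<and> A \<subset> B}"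
  then have step: "U i \<subset> U (Suc i)" and up: "up_closed (U i)" for i by auto
  have mono: "U i \<subseteq> U j" if "i \<le> j" for i j
    by (rule lift_Suc_mono_le[OF _ that]) (use step in blast)
  obtain f where f: "\<And>i. f i \<in> U (Suc i) - U i" using psubset_imp_ex_mem[OF step] by metis
  obtain r :: "nat \<Rightarrow> nat" where r: "strict_mono r" "mono (f \<circ> r)" using dickson by blast
  have "r 0 < r 1" using r(1) by (simp add: strict_mono_def)
  then have "f (r 0) \<in> U (r 1)" using f[of "r 0"] mono[of "Suc (r 0)" "r 1"] by auto
  moreover have "f (r 0) \<le> f (r 1)" using r(2) by (auto simp: mono_def)
  ultimately have "f (r 1) \<in> U (r 1)" using up up_closedD by blast
  then show False using f by blast
qed

section \<open>Changing finitely many monomials\<close>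

text \<open>
  Points are added in decreasing order, so that each stage stays up-closed.
\<close>

lemma point_filtration:
  assumes "finite (B - A)" "A \<subseteq> B" "up_closed A" "up_closed B"
  shows "\<exists>c. cell_filtration A c B \<and> snd ` set c \<subseteq> {UNIV}"
  using assms
proof (induction "card (B - A)" arbitrary: A rule: less_induct)
  case less
  show ?case
  proof (cases "B - A = {}")
    case True
    then have "cell_filtration A [] B" using less by auto
    then show ?thesis by (intro exI[of _ "[]"]) auto
  next
    case False
    obtain w where w: "w \<in> B - A" "\<And>z. z \<in> B - A \<Longrightarrow> w \<le> z \<Longrightarrow> w = z"
      using finite_has_maximal[OF less.prems(1) False] by auto
    have up: "up_closed (A \<union> cell w UNIV)"
      unfolding up_closed_def cell_UNIV
    proof safe
      fix x y assume "x \<in> A" "x \<le> y" "y \<notin> A"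
      then show "y = w" using less.prems(3) up_closedD by blast
    next
      fix y assume "w \<le> y" "y \<notin> A"
      then show "y = w" using w(2)[of y] w(1) less.prems(4) up_closedD by blast
    qed
    have "card (B - (A \<union> cell w UNIV)) < card (B - A)"
      using w(1) less.prems(1) by (intro psubset_card_mono) (auto simp: cell_UNIV)
    from less.hyps[OF this] obtain c
      where "cell_filtration (A \<union> cell w UNIV) c B" "snd ` set c \<subseteq> {UNIV}"
      using less.prems w(1) up by (auto simp: cell_UNIV)
    then have "cell_filtration A ((w, UNIV) # c) B" "snd ` set ((w, UNIV) # c) \<subseteq> {UNIV}"
      using w(1) up by (auto simp: cell_UNIV)
    then show ?thesis by blast
  qed
qed

lemma pretty_points_append:
  assumes "snd ` set d \<subseteq> {UNIV}" "pretty c"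
  shows "pretty (d @ c)"
proof -
  have "pretty d" using assms(1)
    by (induction d) (auto simp: pretty_def)
  then show ?thesis using assms by (auto simp: pretty_append)
qed

lemma cell_infinite:
  assumes "F \<noteq> UNIV" and "w' \<in> cell w F"
  shows "infinite ({w'..} \<inter> cell w F)"
proof -
  obtain i where i: "i \<notin> F" using assms by auto
  have "inj (\<lambda>n. w'(i := w' i + n))" by (auto simp: inj_def fun_upd_def fun_eq_iff)
  moreover have "range (\<lambda>n. w'(i := w' i + n)) \<subseteq> {w'..} \<inter> cell w F"
    using i assms(2) by (auto simp: cell_def le_fun_def trans_le_add1)
  ultimately show ?thesis using range_inj_infinite finite_subset by blast
qed

text \<open>
  From \<open>B\<close> to \<open>A\<close>, the finitely many points are put in front, which keeps the filtration pretty.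
  Conversely, prettiness forces all one-point cells of a filtration of \<open>A\<close> to come first.  Let
  \<open>C\<close> be the set reached after them.  A point in one of the remaining cells has infinitely many
  points of this cell above it; if it were in \<open>B\<close>, they would all be in \<open>B - A\<close>, which is
  finite.  Hence \<open>B \<subseteq> C\<close>, and one gets from \<open>B\<close> to \<open>C\<close> by adding points.
\<close>

lemma cell_pretty_clean_finite_change:
  assumes "A \<subseteq> B" "finite (B - A)" "up_closed A" "up_closed B"
  shows "cell_pretty_clean A \<longleftrightarrow> cell_pretty_clean B"
proof
  assume "cell_pretty_clean B"
  then obtain c where c: "cell_filtration B c UNIV" "pretty c" by (auto simp: cell_pretty_clean_def)
  obtain d where d: "cell_filtration A d B" "snd ` set d \<subseteq> {UNIV}"
    using point_filtration assms by blast
  have "cell_filtration A (d @ c) UNIV" using c(1) d(1) by (auto simp: cell_filtration_append)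
  moreover have "pretty (d @ c)" using d(2) c(2) by (rule pretty_points_append)
  ultimately show "cell_pretty_clean A" unfolding cell_pretty_clean_def by blast
next
  assume "cell_pretty_clean A"
  then obtain c where c: "cell_filtration A c UNIV" "pretty c" by (auto simp: cell_pretty_clean_def)
  define c1 where "c1 = takeWhile (\<lambda>x. snd x = UNIV) c"
  define c2 where "c2 = dropWhile (\<lambda>x. snd x = UNIV) c"
  have cc: "c = c1 @ c2" by (simp add: c1_def c2_def)
  have c1: "snd ` set c1 \<subseteq> {UNIV}" using set_takeWhileD by (fastforce simp: c1_def)
  have c2: "pretty c2" "UNIV \<notin> snd ` set c2"
  proof -
    show "pretty c2" using c(2) by (simp add: cc pretty_append)
    show "UNIV \<notin> snd ` set c2"
    proof (cases c2)
      case (Cons x c')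
      then have "snd x \<noteq> UNIV" using hd_dropWhile[of "\<lambda>x. snd x = UNIV" c] by (auto simp: c2_def)
      then show ?thesis using \<open>pretty c2\<close> Cons by (auto simp: pretty_Cons)
    qed simp
  qed
  obtain C where C: "cell_filtration A c1 C" "cell_filtration C c2 UNIV"
    using c(1) by (auto simp: cc cell_filtration_append)
  have AC: "A \<subseteq> C" using cell_filtration_union[OF C(1)] by auto
  have "finite (C - A)"
  proof (rule finite_subset)
    show "C - A \<subseteq> fst ` set c1"
      using cell_filtration_union[OF C(1)] c1 by (force simp: cell_UNIV)
  qed simp
  have upC: "up_closed C"
    using C(1) assms(3) by (induction c1 arbitrary: A) auto
  have "B \<subseteq> C"
  proof
    fix w assume "w \<in> B"
    show "w \<in> C"
    proof (rule ccontr)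
      assume "w \<notin> C"
      then obtain w' F where wF: "(w', F) \<in> set c2" "w \<in> cell w' F"
        using cell_filtration_union[OF C(2)] by auto
      have "F \<noteq> UNIV" using wF c2 by force
      from cell_infinite[OF this wF(2)] have "infinite ({w..} \<inter> cell w' F)" .
      moreover have "{w..} \<inter> cell w' F \<subseteq> B - A"
        using \<open>w \<in> B\<close> up_closedD[OF assms(4)] cell_filtration_disjoint[OF C(2) wF(1)] AC by auto
      ultimately show False using assms(2) finite_subset by blast
    qed
  qed
  have "finite (C - B)" using \<open>finite (C - A)\<close> assms(1) by (rule_tac finite_subset) auto
  then obtain d where d: "cell_filtration B d C" "snd ` set d \<subseteq> {UNIV}"
    using point_filtration \<open>B \<subseteq> C\<close> assms(4) upC by blast
  have "cell_filtration B (d @ c2) UNIV" using C(2) d(1) by (auto simp: cell_filtration_append)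
  moreover have "pretty (d @ c2)" using d(2) c2(1) by (rule pretty_points_append)
  ultimately show "cell_pretty_clean B" unfolding cell_pretty_clean_def by blast
qed

section \<open>Saturation\<close>

text \<open>
  The exponents of the saturation of a monomial ideal with respect to the maximal ideal.
\<close>

definition saturation :: "('n \<Rightarrow> nat) set \<Rightarrow> ('n \<Rightarrow> nat) set"
  where "saturation A = {w. finite ({w..} - A)}"

lemma saturation_up_closed: "up_closed (saturation A)"
  unfolding up_closed_def saturation_def
proof safe
  fix x y :: "'a \<Rightarrow> nat" assume "finite ({x..} - A)" "x \<le> y"
  then show "finite ({y..} - A)" by (elim finite_subset[rotated]) auto
qed

lemma subset_saturation: "up_closed A \<Longrightarrow> A \<subseteq> saturation A"
  unfolding saturation_def
proof safe
  fix x assume "up_closed A" "x \<in> A"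
  then have empty: "{x..} - A = {}" by (auto dest: up_closedD)
  show "finite ({x..} - A)" unfolding empty by simp
qed

lemma finite_saturation_diff:
  fixes A :: "('n::finite \<Rightarrow> nat) set"
  shows "finite (saturation A - A)"
proof (rule finite_if_finitely_many_above)
  fix w assume "w \<in> saturation A - A"
  then have "finite ({w..} - A)" by (simp add: saturation_def)
  then show "finite ({w..} \<inter> (saturation A - A))" by (elim finite_subset[rotated]) auto
qed

lemma saturation_ray:
  assumes "w \<in> saturation A"
  shows "\<exists>N. \<forall>n\<ge>N. w(i := w i + n) \<in> A"
proof -
  define R where "R = {n. w(i := w i + n) \<notin> A}"
  have "inj_on (\<lambda>n. w(i := w i + n)) R" by (auto simp: inj_on_def fun_upd_def fun_eq_iff)
  moreover have "(\<lambda>n. w(i := w i + n)) ` R \<subseteq> {w..} - A" by (auto simp: R_def le_fun_def)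
  moreover have "finite ({w..} - A)" using assms by (simp add: saturation_def)
  ultimately have "finite R" using finite_imageD finite_subset by blast
  then obtain N where "\<forall>n\<in>R. n < N" unfolding finite_nat_set_iff_bounded by blast
  then have "\<forall>n\<ge>N. w(i := w i + n) \<in> A" by (auto simp: R_def not_less[symmetric])
  then show ?thesis by blast
qed

text \<open>
  The points above \<open>z\<close> are \<open>z\<close> itself and the points above its finitely many successors.
\<close>

lemma saturation_saturated:
  fixes z :: "'n::finite \<Rightarrow> nat"
  assumes "\<And>i. z(i := Suc (z i)) \<in> saturation A"
  shows "z \<in> saturation A"
proof -
  have "{z..} - A \<subseteq> insert z (\<Union>i. {z(i := Suc (z i))..} - A)"
  proof
    fix y assume y: "y \<in> {z..} - A"
    show "y \<in> insert z (\<Union>i. {z(i := Suc (z i))..} - A)"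
    proof (cases "y = z")
      case False
      then obtain i where "y i \<noteq> z i" by auto
      then have "z(i := Suc (z i)) \<le> y" using y by (auto simp: le_fun_def Suc_le_eq order.not_eq_order_implies_strict)
      then show ?thesis using y by auto
    qed simp
  qed
  moreover have "finite (insert z (\<Union>i. {z(i := Suc (z i))..} - A))"
    using assms unfolding saturation_def finite_insert by (intro finite_UN_I) auto
  ultimately show ?thesis using finite_subset by (auto simp: saturation_def)
qed

text \<open>
  Among the colon sets of the saturation at points \<open>z \<ge> w\<close> outside it, choose a maximal one.
  Maximality makes it prime, that is, given by a set \<open>F\<close> of variables; it contains \<open>v\<close>
  because of the step at \<open>w\<close>, and misses some variable \<open>k\<close> because the saturation is saturated.
  Moving \<open>z\<close> far enough in direction \<open>k\<close> does not change the colon set of the saturation and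
  makes that of \<open>A\<close> equal to it.
\<close>

lemma prime_colon_of_unsaturated_step:
  fixes w :: "'n::finite \<Rightarrow> nat"
  assumes "up_closed A" "w \<notin> saturation A" "w(v := Suc (w v)) \<in> saturation A"
  shows "\<exists>z F. v \<in> F \<and> F \<noteq> UNIV \<and> (\<forall>e. (\<lambda>i. z i + e i) \<in> A \<longleftrightarrow> (\<exists>i\<in>F. e i \<noteq> 0))"
proof -
  define J where "J = saturation A"
  have upJ: "up_closed J" and AJ: "A \<subseteq> J"
    using saturation_up_closed subset_saturation assms by (auto simp: J_def)
  define colon where "colon z = {e. (\<lambda>i. z i + e i) \<in> J}" for z :: "'n \<Rightarrow> nat"
  have up_colon: "up_closed (colon z)" for z
    unfolding up_closed_def colon_def using upJ
    by (auto simp: le_fun_def intro: up_closedD)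
  have "colon w \<in> {colon z | z. w \<le> z \<and> z \<notin> J}" using assms by (auto simp: J_def)
  from wfE_min[OF wf_up_closed_superset this]
  obtain C where C: "C \<in> {colon z | z. w \<le> z \<and> z \<notin> J}"
    and Cmax': "\<And>B. (B, C) \<in> {(B, A). up_closed A \<and> up_closed B \<and> A \<subset> B} \<Longrightarrow>
      B \<notin> {colon z | z. w \<le> z \<and> z \<notin> J}" by blast
  obtain z where z: "w \<le> z" "z \<notin> J" "C = colon z" using C by blast
  have Cmax: "colon y = colon z" if "z \<le> y" "y \<notin> J" for y
  proof -
    have "colon z \<subseteq> colon y"
      using that upJ by (auto simp: colon_def le_fun_def elim!: up_closedD)
    moreover have "colon y \<in> {colon z | z. w \<le> z \<and> z \<notin> J}" using that z order_trans by blast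
    ultimately show ?thesis using Cmax'[of "colon y"] up_colon z(3) by auto
  qed
  define F where "F = {i. z(i := Suc (z i)) \<in> J}"
  have vF: "v \<in> F"
  proof -
    have "w(v := Suc (w v)) \<le> z(v := Suc (z v))" using z(1) by (auto simp: le_fun_def)
    then show ?thesis using assms(3) upJ up_closedD by (auto simp: F_def J_def)
  qed
  have F: "F \<noteq> UNIV" using saturation_saturated[of z A] z(2) by (auto simp: F_def J_def)
  have off: "(\<lambda>i. z i + e i) \<notin> J" if "\<forall>i\<in>F. e i = 0" for e
    using that
  proof (induction "sum e UNIV" arbitrary: e)
    case 0
    then have "(\<lambda>i. z i + e i) = z" by auto
    then show ?case using z by simp
  next
    case (Suc n)
    obtain i where i: "e i \<noteq> 0" using Suc(2) by (metis nat.distinct(1) sum.neutral)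
    define e' where "e' = e(i := e i - 1)"
    have "sum e UNIV = Suc (sum e' UNIV)"
      using i by (subst (1 2) sum.remove[of UNIV i]) (auto simp: e'_def)
    then have "(\<lambda>i. z i + e' i) \<notin> J" using Suc by (intro Suc(1)) (auto simp: e'_def)
    then have "colon (\<lambda>i. z i + e' i) = colon z" by (intro Cmax) (auto simp: le_fun_def)
    moreover have notin: "(\<lambda>j. if j = i then 1 else 0) \<notin> colon z"
    proof -
      have "(\<lambda>j. z j + (if j = i then 1 else 0)) = z(i := Suc (z i))" by auto
      then show ?thesis using i Suc(3) by (auto simp: colon_def F_def)
    qed
    ultimately have "(\<lambda>j. if j = i then 1 else 0) \<notin> colon (\<lambda>i. z i + e' i)" by simp
    then have "(\<lambda>j. z j + e' j + (if j = i then 1 else 0)) \<notin> J"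
      unfolding colon_def mem_Collect_eq .
    moreover have "(\<lambda>j. z j + e' j + (if j = i then 1 else 0)) = (\<lambda>j. z j + e j)"
      using i by (auto simp: e'_def)
    ultimately show ?case by simp
  qed
  obtain k where k: "k \<notin> F" using F by auto
  have "\<exists>N. \<forall>n\<ge>N. (z(f := Suc (z f)))(k := (z(f := Suc (z f))) k + n) \<in> A" if "f \<in> F" for f
    using that by (intro saturation_ray) (simp add: F_def J_def)
  then obtain N where N: "\<And>f n. f \<in> F \<Longrightarrow> N f \<le> n \<Longrightarrow>
    (z(f := Suc (z f)))(k := (z(f := Suc (z f))) k + n) \<in> A" by metis
  define m where "m = Max (range N)"
  have m: "N f \<le> m" for f by (simp add: m_def)
  define y where "y = z(k := z k + m)"
  have "(\<lambda>i. y i + e i) \<in> A \<longleftrightarrow> (\<exists>i\<in>F. e i \<noteq> 0)" for e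
  proof
    assume inA: "(\<lambda>i. y i + e i) \<in> A"
    show "\<exists>i\<in>F. e i \<noteq> 0"
    proof (rule ccontr)
      assume "\<not> (\<exists>i\<in>F. e i \<noteq> 0)"
      then have "(\<lambda>i. z i + (e(k := e k + m)) i) \<notin> J" using k by (intro off) auto
      moreover have "(\<lambda>i. z i + (e(k := e k + m)) i) = (\<lambda>i. y i + e i)" by (auto simp: y_def)
      ultimately show False using inA AJ by auto
    qed
  next
    assume "\<exists>i\<in>F. e i \<noteq> 0"
    then obtain f where f: "f \<in> F" "e f \<noteq> 0" by blast
    have "f \<noteq> k" using f k by auto
    have "(z(f := Suc (z f)))(k := (z(f := Suc (z f))) k + m) \<le> (\<lambda>i. y i + e i)"
      using f \<open>f \<noteq> k\<close> by (auto simp: y_def le_fun_def)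
    then show "(\<lambda>i. y i + e i) \<in> A" using N[OF f(1) m] assms(1) up_closedD by blast
  qed
  then show ?thesis using vF F by blast
qed

definition independent_of :: "'n set \<Rightarrow> ('n \<Rightarrow> nat) set \<Rightarrow> bool"
  where "independent_of V A \<longleftrightarrow>
    (\<forall>w w'. (\<forall>i. i \<notin> V \<longrightarrow> w i = w' i) \<longrightarrow> w \<in> A \<longrightarrow> w' \<in> A)"

text \<open>
  Two points that agree off \<open>V\<close> are compared through their pointwise maximum, from which one
  descends by single steps in directions in \<open>V\<close>.
\<close>

lemma independent_ofI:
  fixes J :: "('n::finite \<Rightarrow> nat) set"
  assumes "up_closed J" and step: "\<And>v w. v \<in> V \<Longrightarrow> w(v := Suc (w v)) \<in> J \<Longrightarrow> w \<in> J"
  shows "independent_of V J"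
proof -
  have down: "w \<in> J" if "w \<le> w'" "\<And>i. i \<notin> V \<Longrightarrow> w i = w' i" "w' \<in> J" for w w'
    using that
  proof (induction "\<Sum>i\<in>UNIV. w' i - w i" arbitrary: w)
    case 0
    then have "w = w'" by (auto simp: le_fun_def intro: antisym)
    then show ?case using 0 by simp
  next
    case (Suc n)
    obtain v where "w' v - w v \<noteq> 0" using Suc(2) by (metis (mono_tags, lifting) nat.distinct(1) sum.neutral)
    then have v: "w v < w' v" by simp
    have vV: "v \<in> V" using v Suc.prems(2) by force
    have "(\<Sum>i\<in>UNIV. w' i - w i) = Suc (\<Sum>i\<in>UNIV. w' i - (w(v := Suc (w v))) i)"
      using v by (subst (1 2) sum.remove[of UNIV v]) auto
    then have n: "n = (\<Sum>i\<in>UNIV. w' i - (w(v := Suc (w v))) i)" using Suc(2) by linarith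
    have le: "w(v := Suc (w v)) \<le> w'" using Suc.prems(1) v by (auto simp: le_fun_def)
    have eq: "(w(v := Suc (w v))) i = w' i" if "i \<notin> V" for i
      using Suc.prems(2)[OF that] that vV by auto
    have "w(v := Suc (w v)) \<in> J" using Suc(1)[OF n le eq Suc.prems(3)] .
    then show ?case using step vV by blast
  qed
  show ?thesis
    unfolding independent_of_def
  proof (intro allI impI)
    fix w w' assume *: "\<forall>i. i \<notin> V \<longrightarrow> w i = w' i" "w \<in> J"
    have "(\<lambda>i. max (w i) (w' i)) \<in> J" using *(2) assms(1) by (elim up_closedD) (auto simp: le_fun_def)
    then show "w' \<in> J" using * by (intro down[of w' "\<lambda>i. max (w i) (w' i)"]) (auto simp: le_fun_def)
  qed
qed

text \<open>
  The hypothesis is the combinatorial form of filter-regularity of a monomial with support \<open>V\<close>: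
  an associated prime witnessed by a monomial, other than the maximal ideal, contains no variable
  in \<open>V\<close>.
\<close>

lemma saturation_independent_of:
  fixes A :: "('n::finite \<Rightarrow> nat) set"
  assumes "up_closed A"
    and "\<And>z F. F \<noteq> UNIV \<Longrightarrow> (\<forall>e. (\<lambda>i. z i + e i) \<in> A \<longleftrightarrow> (\<exists>i\<in>F. e i \<noteq> 0)) \<Longrightarrow> F \<inter> V = {}"
  shows "independent_of V (saturation A)"
proof (rule independent_ofI[OF saturation_up_closed])
  fix v w assume "v \<in> V" "w(v := Suc (w v)) \<in> saturation A"
  then show "w \<in> saturation A"
    using prime_colon_of_unsaturated_step[OF assms(1), of w v] assms(2) by blast
qed

section \<open>Fixing the exponents of some variables\<close>

definition slice :: "'n set \<Rightarrow> ('n \<Rightarrow> nat) \<Rightarrow> ('n \<Rightarrow> nat) set \<Rightarrow> ('n \<Rightarrow> nat) set"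
  where "slice V t A = {e. override_on e t V \<in> A}"

text \<open>
  The slice at \<open>t\<close> cuts a cell either in the empty set or in a cell again; this is the criterion
  for the second case.
\<close>

definition slice_meets :: "'n set \<Rightarrow> ('n \<Rightarrow> nat) \<Rightarrow> ('n \<Rightarrow> nat) \<times> 'n set \<Rightarrow> bool"
  where "slice_meets V t x \<longleftrightarrow> (\<forall>i\<in>V. fst x i \<le> t i \<and> (i \<in> snd x \<longrightarrow> t i = fst x i))"

lemma slice_cell:
  "slice V t (cell w F) =
    (if slice_meets V t (w, F) then cell (override_on w (\<lambda>_. 0) V) (F - V) else {})"
proof -
  have "e \<in> slice V t (cell w F) \<longleftrightarrow> slice_meets V t (w, F) \<and> e \<in> cell (override_on w (\<lambda>_. 0) V) (F - V)"
    for e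
    unfolding slice_def cell_def slice_meets_def le_fun_def mem_Collect_eq override_on_def fst_conv snd_conv
    by (auto split: if_splits; metis)
  then show ?thesis by auto
qed

lemma slice_Un: "slice V t (A \<union> B) = slice V t A \<union> slice V t B"
  by (auto simp: slice_def)

lemma slice_up_closed: "up_closed A \<Longrightarrow> up_closed (slice V t A)"
  by (auto simp: up_closed_def slice_def le_fun_def override_on_def)

lemma slice_independent_of: "independent_of V A \<Longrightarrow> slice V t A = A"
proof -
  assume A: "independent_of V A"
  have "override_on e t V \<in> A \<longleftrightarrow> e \<in> A" for e
    using A[unfolded independent_of_def, rule_format, of e "override_on e t V"]
      A[unfolded independent_of_def, rule_format, of "override_on e t V" e] by auto
  then show ?thesis by (simp add: slice_def)
qed

definition slice_cells ::
  "'n set \<Rightarrow> ('n \<Rightarrow> nat) \<Rightarrow> (('n \<Rightarrow> nat) \<times> 'n set) list \<Rightarrow> (('n \<Rightarrow> nat) \<times> 'n set) list"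
  where "slice_cells V t c =
    map (\<lambda>(w, F). (override_on w (\<lambda>_. 0) V, F - V)) (filter (slice_meets V t) c)"

lemma cell_filtration_slice:
  "cell_filtration A c B \<Longrightarrow> cell_filtration (slice V t A) (slice_cells V t c) (slice V t B)"
proof (induction c arbitrary: A)
  case Nil then show ?case by (simp add: slice_cells_def)
next
  case (Cons x c)
  obtain w F where x: "x = (w, F)" by fastforce
  have IH: "cell_filtration (slice V t A \<union> slice V t (cell w F)) (slice_cells V t c) (slice V t B)"
    using Cons x by (auto simp: slice_Un[symmetric])
  have "up_closed (slice V t A \<union> slice V t (cell w F))"
    using Cons x by (auto simp: slice_Un[symmetric] intro: slice_up_closed)
  moreover have "slice V t (cell w F) \<inter> slice V t A = {}" using Cons x by (auto simp: slice_def)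
  ultimately show ?case using IH
    by (cases "slice_meets V t x") (simp_all add: x slice_cells_def slice_cell)
qed

text \<open>
  If all surviving cells have the same variables in \<open>V\<close>, dropping these does not create new
  inclusions.
\<close>

lemma pretty_slice_cells:
  assumes "pretty c" and "\<And>x. x \<in> set c \<Longrightarrow> slice_meets V t x \<Longrightarrow> snd x \<inter> V = T"
  shows "pretty (slice_cells V t c)"
proof -
  have "sorted_wrt (\<lambda>x y. snd x \<subseteq> snd y \<longrightarrow> snd x = snd y) (filter (slice_meets V t) c)"
    using assms(1) by (auto simp: pretty_def sorted_wrt_map intro: sorted_wrt_filter)
  then have "sorted_wrt (\<lambda>x y. snd x - V \<subseteq> snd y - V \<longrightarrow> snd x - V = snd y - V)
    (filter (slice_meets V t) c)"
  proof (rule sorted_wrt_mono_rel[rotated])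
    fix x y assume "x \<in> set (filter (slice_meets V t) c)" "y \<in> set (filter (slice_meets V t) c)"
    then have "snd x \<inter> V = T" "snd y \<inter> V = T" using assms(2) by auto
    moreover assume "snd x \<subseteq> snd y \<longrightarrow> snd x = snd y"
    ultimately show "snd x - V \<subseteq> snd y - V \<longrightarrow> snd x - V = snd y - V" by blast
  qed
  then show ?thesis by (simp add: pretty_def slice_cells_def sorted_wrt_map case_prod_beta)
qed

lemma cell_list_bounded:
  fixes c :: "(('n::finite \<Rightarrow> nat) \<times> 'n set) list"
  shows "\<exists>L. \<forall>x\<in>set c. \<forall>i. fst x i < L"
proof -
  have "finite (\<Union>x\<in>set c. range (fst x))" by auto
  then obtain L where "\<forall>k\<in>(\<Union>x\<in>set c. range (fst x)). k < L"
    using finite_nat_set_iff_bounded by blast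
  then show ?thesis by blast
qed

section \<open>Adjoining a monomial in independent variables\<close>

text \<open>
  The part of a cell that is not above \<open>u\<close> is filled up by induction on the degree of \<open>u\<close>.  If
  \<open>v\<close> divides \<open>u\<close> and \<open>u' = u/v\<close>, the points of the cell that are above \<open>u'\<close> but not above \<open>u\<close>
  are those whose exponent at \<open>v\<close> equals that of \<open>u'\<close>, hence form a cell based at \<open>w + u'\<close> with
  \<open>v\<close> as an additional variable.  Adding it to \<open>B\<close> leaves the same problem for \<open>u'\<close>.
\<close>

lemma refine_cell:
  fixes u :: "'n::finite \<Rightarrow> nat"
  assumes "\<And>i. u i \<noteq> 0 \<Longrightarrow> i \<in> V" "F \<inter> V = {}" "\<And>i. i \<in> V \<Longrightarrow> w i = 0"
    and "up_closed B" "up_closed (B \<union> cell w F)" "cell w F \<inter> B = cell w F \<inter> {u..}"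
  shows "\<exists>c. cell_filtration B c (B \<union> cell w F) \<and> snd ` set c \<subseteq> {insert v F | v. v \<in> V}"
  using assms(1,4-)
proof (induction "sum u UNIV" arbitrary: u B)
  case 0
  then have "u = (\<lambda>_. 0)" by auto
  then have "{u..} = UNIV" by (auto simp: le_fun_def)
  then have "B = B \<union> cell w F" using 0(5) by blast
  then have "cell_filtration B [] (B \<union> cell w F)" by simp
  then show ?case by (intro exI[of _ "[]"]) auto
next
  case (Suc n)
  obtain v where v: "u v \<noteq> 0" using Suc(2) by (metis nat.distinct(1) sum.neutral)
  then have vV: "v \<in> V" using Suc(3) by blast
  define u' where "u' = u(v := u v - 1)"
  define x where "x = (\<lambda>i. w i + u' i)"
  have sum: "sum u UNIV = Suc (sum u' UNIV)"
    using v by (subst (1 2) sum.remove[of UNIV v]) (auto simp: u'_def)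
  have u'V: "u' i \<noteq> 0 \<Longrightarrow> i \<in> V" for i using Suc(3)[of i] v vV by (auto simp: u'_def split: if_splits)
  have ge: "x \<le> z \<longleftrightarrow> w \<le> z \<and> u' \<le> z" for z
  proof -
    have "x i = max (w i) (u' i)" for i
      using assms(3)[of i] u'V[of i] by (cases "u' i = 0") (auto simp: x_def)
    then show ?thesis by (simp add: le_fun_def) blast
  qed
  have geu: "u \<le> z \<longleftrightarrow> u' \<le> z \<and> z v \<noteq> u' v" for z
  proof
    assume l: "u \<le> z"
    have "u' v < u v" using v by (simp add: u'_def)
    then have "u' v < z v" using le_funD[OF l, of v] by simp
    moreover have "u' \<le> u" by (simp add: u'_def le_fun_def)
    ultimately show "u' \<le> z \<and> z v \<noteq> u' v" using l by (auto intro: order_trans)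
  next
    assume "u' \<le> z \<and> z v \<noteq> u' v"
    then show "u \<le> z" using v by (auto simp: u'_def le_fun_def) (metis Suc_leI Suc_pred le_neq_implies_less neq0_conv)
  qed
  have xF: "i \<in> F \<Longrightarrow> x i = w i" for i using u'V[of i] assms(2) by (auto simp: x_def)
  have xv: "x v = u' v" using assms(3) vV by (simp add: x_def)
  have new: "cell x (insert v F) = cell w F \<inter> {u'..} - {u..}"
    using ge geu xF xv by (auto simp: cell_def)
  define B' where "B' = B \<union> cell x (insert v F)"
  have meet: "cell w F \<inter> B' = cell w F \<inter> {u'..}"
    using Suc.prems(4) geu by (auto simp: B'_def new)
  have join: "B' \<union> cell w F = B \<union> cell w F" by (auto simp: B'_def new)
  have up: "up_closed B'"
    unfolding up_closed_def
  proof safe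
    fix z y assume *: "z \<in> B'" "z \<le> y"
    show "y \<in> B'"
    proof (cases "z \<in> B")
      case True then show ?thesis using * Suc.prems(2) up_closedD by (auto simp: B'_def)
    next
      case False
      then have z: "z \<in> cell w F" "u' \<le> z" using * by (auto simp: B'_def new)
      then have "y \<in> B \<union> cell w F" using * Suc.prems(3) up_closedD by blast
      moreover have "u' \<le> y" using z * by order
      ultimately show ?thesis using meet by (auto simp: B'_def)
    qed
  qed
  have "\<exists>c. cell_filtration B' c (B' \<union> cell w F) \<and> snd ` set c \<subseteq> {insert v F | v. v \<in> V}"
    by (rule Suc(1)[of u' B']) (use Suc sum u'V up meet join in auto)
  then obtain c where c: "cell_filtration B' c (B \<union> cell w F)" "snd ` set c \<subseteq> {insert v F | v. v \<in> V}"
    by (auto simp: join)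
  have "cell x (insert v F) \<inter> B = {}" using new Suc.prems(4) by auto
  then have "cell_filtration B ((x, insert v F) # c) (B \<union> cell w F)"
    using c up by (auto simp: B'_def)
  moreover have "snd ` set ((x, insert v F) # c) \<subseteq> {insert v F | v. v \<in> V}" using c vV by auto
  ultimately show ?case by blast
qed

lemma pretty_insert_const:
  assumes "snd ` set c \<subseteq> {insert v F | v. v \<in> V}" "F \<inter> V = {}"
  shows "pretty c"
  using assms(1)
proof (induction c)
  case Nil then show ?case by (simp add: pretty_def)
next
  case (Cons x c)
  have "pretty c" using Cons by simp
  moreover have "snd x = G" if G: "G \<in> snd ` set c" "snd x \<subseteq> G" for G
  proof -
    obtain v where v: "snd x = insert v F" "v \<in> V" using Cons.prems by auto
    obtain v' where v': "G = insert v' F" using Cons.prems G(1) by auto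
    have "v = v'" using v v' G(2) assms(2) by blast
    then show ?thesis using v v' by simp
  qed
  ultimately show ?case by (auto simp: pretty_Cons)
qed

text \<open>
  The last conjunct strengthens the induction: it makes the pieces of different cells comparable
  only if the cells were, as two sets \<open>F \<union> {v}\<close> and \<open>G \<union> {v'}\<close> with \<open>F\<close> and \<open>G\<close> disjoint from
  \<open>V\<close> are nested only if \<open>v = v'\<close> and \<open>F\<close> and \<open>G\<close> are nested.
\<close>

lemma refine_filtration:
  fixes u :: "'n::finite \<Rightarrow> nat"
  assumes "cell_filtration B c UNIV" "pretty c" "up_closed B" "V = {i. u i \<noteq> 0}"
    and "\<And>w F. (w, F) \<in> set c \<Longrightarrow> F \<inter> V = {} \<and> (\<forall>i\<in>V. w i = 0)"
  shows "\<exists>d. cell_filtration (B \<union> {u..}) d UNIV \<and> pretty d \<and>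
    snd ` set d \<subseteq> {insert v F | v F. v \<in> V \<and> F \<in> snd ` set c}"
  using assms(1-3,5)
proof (induction c arbitrary: B)
  case Nil
  then show ?case by (intro exI[of _ "[]"]) (auto simp: pretty_def)
next
  case (Cons x c)
  obtain w F where x: "x = (w, F)" by fastforce
  have wF: "F \<inter> V = {}" "\<And>i. i \<in> V \<Longrightarrow> w i = 0" using Cons.prems(4)[of w F] x by auto
  have up: "up_closed (B \<union> cell w F)" and disj: "cell w F \<inter> B = {}"
    and rest: "cell_filtration (B \<union> cell w F) c UNIV" using Cons.prems x by auto
  have "\<exists>d. cell_filtration (B \<union> cell w F \<union> {u..}) d UNIV \<and> pretty d \<and>
    snd ` set d \<subseteq> {insert v F | v F. v \<in> V \<and> F \<in> snd ` set c}"
    by (rule Cons.IH) (use Cons.prems rest up in \<open>auto simp: pretty_Cons\<close>)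
  then obtain d where d: "cell_filtration (B \<union> cell w F \<union> {u..}) d UNIV" "pretty d"
    "snd ` set d \<subseteq> {insert v F | v F. v \<in> V \<and> F \<in> snd ` set c}" by blast
  have "\<exists>e. cell_filtration (B \<union> {u..}) e ((B \<union> {u..}) \<union> cell w F) \<and>
    snd ` set e \<subseteq> {insert v F | v. v \<in> V}"
  proof (rule refine_cell[of u])
    show "up_closed (B \<union> {u..})" using Cons.prems(3) up_closed_Un up_closed_atLeast by blast
    have "B \<union> {u..} \<union> cell w F = (B \<union> cell w F) \<union> {u..}" by auto
    then show "up_closed (B \<union> {u..} \<union> cell w F)" using up up_closed_Un up_closed_atLeast by metis
  qed (use wF disj assms(4) in auto)
  then obtain e where e: "cell_filtration (B \<union> {u..}) e ((B \<union> {u..}) \<union> cell w F)"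
    "snd ` set e \<subseteq> {insert v F | v. v \<in> V}" by blast
  have "cell_filtration (B \<union> {u..}) (e @ d) UNIV"
    using e(1) d(1) by (auto simp: cell_filtration_append Un_ac)
  moreover have "pretty (e @ d)"
    unfolding pretty_append
  proof (intro conjI ballI impI)
    show "pretty e" using e wF pretty_insert_const by blast
    show "pretty d" by fact
    fix G H assume "G \<in> snd ` set e" "H \<in> snd ` set d" and GH: "G \<subseteq> H"
    obtain v where G: "G = insert v F" "v \<in> V" using subsetD[OF e(2) \<open>G \<in> snd ` set e\<close>] by auto
    obtain v' H' where H: "H = insert v' H'" "v' \<in> V" "H' \<in> snd ` set c"
      using subsetD[OF d(3) \<open>H \<in> snd ` set d\<close>] by auto
    obtain x' where "(x', H') \<in> set c" using H(3) by auto
    then have "(x', H') \<in> set (x # c)" by simp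
    then have "H' \<inter> V = {}" using Cons.prems(4) by blast
    then have "v = v'" "F \<subseteq> H'" using G(2) H(2) GH wF(1) unfolding G(1) H(1) by auto
    moreover have "F \<subseteq> H' \<Longrightarrow> F = H'" using Cons.prems(2) x H by (auto simp: pretty_Cons)
    ultimately show "G = H" using G H by simp
  qed
  moreover have "snd ` set (e @ d) \<subseteq> {insert v F | v F. v \<in> V \<and> F \<in> snd ` set (x # c)}"
  proof -
    have "{insert v F | v. v \<in> V} \<subseteq> {insert v F | v F. v \<in> V \<and> F \<in> snd ` set (x # c)}"
      using x by auto
    moreover have "{insert v F | v F. v \<in> V \<and> F \<in> snd ` set c} \<subseteq>
      {insert v F | v F. v \<in> V \<and> F \<in> snd ` set (x # c)}" by auto
    ultimately show ?thesis using e(2) d(3) unfolding set_append image_Un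
      by (meson Un_least order_trans)
  qed
  ultimately show ?case by blast
qed

text \<open>
  Since \<open>J\<close> is independent of the variables in \<open>u\<close>, every slice of \<open>J\<close> in these variables is
  \<open>J\<close>.  The bound \<open>L\<close> exceeds all base exponents of the given filtration, so a surviving cell
  cannot fix a variable at the value \<open>L\<close>.
\<close>

lemma cell_pretty_clean_adjoin:
  fixes u :: "'n::finite \<Rightarrow> nat"
  assumes "up_closed J" and "independent_of {i. u i \<noteq> 0} J" and "u \<noteq> (\<lambda>_. 0)"
  shows "cell_pretty_clean J \<longleftrightarrow> cell_pretty_clean (J \<union> {u..})"
proof
  define V where "V = {i. u i \<noteq> 0}"
  assume "cell_pretty_clean J"
  then obtain c where c: "cell_filtration J c UNIV" "pretty c" by (auto simp: cell_pretty_clean_def)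
  obtain L where L: "\<forall>x\<in>set c. \<forall>i. fst x i < L" using cell_list_bounded by blast
  define d where "d = slice_cells V (\<lambda>_. L) c"
  have meets: "snd x \<inter> V = {}" if "x \<in> set c" "slice_meets V (\<lambda>_. L) x" for x
  proof (rule ccontr)
    assume "snd x \<inter> V \<noteq> {}"
    then obtain i where i: "i \<in> snd x" "i \<in> V" by blast
    then have "L = fst x i" using that(2) by (auto simp: slice_meets_def)
    then show False using L that(1) by (metis less_irrefl)
  qed
  have "cell_filtration (slice V (\<lambda>_. L) J) d (slice V (\<lambda>_. L) UNIV)"
    unfolding d_def by (rule cell_filtration_slice) (rule c(1))
  then have d: "cell_filtration J d UNIV"
    using assms(2) by (simp add: slice_independent_of V_def slice_def[of _ _ UNIV])
  have "pretty d" unfolding d_def using c(2) meets by (rule pretty_slice_cells)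
  moreover have "F \<inter> V = {} \<and> (\<forall>i\<in>V. w i = 0)" if "(w, F) \<in> set d" for w F
    using that meets by (auto simp: d_def slice_cells_def)
  ultimately show "cell_pretty_clean (J \<union> {u..})"
    unfolding cell_pretty_clean_def
    using refine_filtration[OF d _ assms(1) V_def] by blast
next
  define V where "V = {i. u i \<noteq> 0}"
  assume "cell_pretty_clean (J \<union> {u..})"
  then obtain c where c: "cell_filtration (J \<union> {u..}) c UNIV" "pretty c"
    by (auto simp: cell_pretty_clean_def)
  obtain L where L: "\<forall>x\<in>set c. \<forall>i. fst x i < L" using cell_list_bounded by blast
  obtain v where v: "u v \<noteq> 0" using assms(3) by auto
  then have vV: "v \<in> V" by (simp add: V_def)
  \<comment> \<open>One step below \<open>u\<close> at \<open>v\<close>, so that the slice misses \<open>{u..}\<close>.\<close>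
  define t where "t = (\<lambda>_. L)(v := u v - 1)"
  have "\<not> u \<le> override_on e t V" for e
  proof
    assume "u \<le> override_on e t V"
    from le_funD[OF this, of v] show False using v vV by (simp add: t_def)
  qed
  then have "slice V t {u..} = {}" by (auto simp: slice_def)
  then have "slice V t (J \<union> {u..}) = J"
    using assms(2) by (simp add: slice_Un slice_independent_of V_def)
  then have d: "cell_filtration J (slice_cells V t c) UNIV"
    using cell_filtration_slice[OF c(1), of V t] by (simp add: slice_def[of _ _ UNIV])
  have "snd x \<inter> V = {v}" if x: "x \<in> set c" "slice_meets V t x" for x
  proof -
    have only: "i = v" if "i \<in> snd x" "i \<in> V" for i
    proof (rule ccontr)
      assume "i \<noteq> v"
      then have "L = fst x i" using that x(2) by (auto simp: slice_meets_def t_def)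
      then show False using L x(1) by (metis less_irrefl)
    qed
    have "v \<in> snd x"
    proof (rule ccontr)
      assume "v \<notin> snd x"
      then have disj: "snd x \<inter> V = {}" using only by auto
      \<comment> \<open>A cell not restricting any variable of \<open>u\<close> would reach \<open>{u..}\<close>, which was there before.\<close>
      define z where "z = (\<lambda>i. fst x i + u i)"
      have "z \<in> cell (fst x) (snd x)" using disj by (auto simp: z_def cell_def le_fun_def V_def)
      moreover have "z \<in> {u..}" by (auto simp: z_def le_fun_def)
      moreover have "cell (fst x) (snd x) \<inter> (J \<union> {u..}) = {}"
        using c(1) x(1) by (intro cell_filtration_disjoint) simp_all
      ultimately show False by blast
    qed
    then show ?thesis using only vV by blast
  qed
  with c(2) have "pretty (slice_cells V t c)" by (rule pretty_slice_cells)
  with d show "cell_pretty_clean J" by (auto simp: cell_pretty_clean_def)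
qed

text \<open>
  Passing to the saturation and back changes only finitely many points, also after adjoining
  \<open>{u..}\<close>.
\<close>

lemma cell_pretty_clean_filter_regular:
  fixes A :: "('n::finite \<Rightarrow> nat) set"
  assumes "up_closed A" "u \<noteq> (\<lambda>_. 0)"
    and "\<And>z F. F \<noteq> UNIV \<Longrightarrow> (\<forall>e. (\<lambda>i. z i + e i) \<in> A \<longleftrightarrow> (\<exists>i\<in>F. e i \<noteq> 0)) \<Longrightarrow>
      F \<inter> {i. u i \<noteq> 0} = {}"
  shows "cell_pretty_clean A \<longleftrightarrow> cell_pretty_clean (A \<union> {u..})"
proof -
  let ?J = "saturation A"
  have AJ: "A \<subseteq> ?J" using assms(1) subset_saturation by blast
  have fin: "finite (?J - A)" by (rule finite_saturation_diff)
  have up: "up_closed (A \<union> {u..})" "up_closed (?J \<union> {u..})" "up_closed ?J"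
    using assms(1) up_closed_Un up_closed_atLeast saturation_up_closed by blast+
  have "cell_pretty_clean A \<longleftrightarrow> cell_pretty_clean ?J"
    using AJ fin assms(1) up by (intro cell_pretty_clean_finite_change)
  also have "\<dots> \<longleftrightarrow> cell_pretty_clean (?J \<union> {u..})"
    using saturation_independent_of[OF assms(1,3)] assms(2) up(3)
    by (intro cell_pretty_clean_adjoin) auto
  also have "\<dots> \<longleftrightarrow> cell_pretty_clean (A \<union> {u..})"
  proof (rule cell_pretty_clean_finite_change[symmetric])
    show "finite (?J \<union> {u..} - (A \<union> {u..}))" using fin by (rule_tac finite_subset) auto
  qed (use AJ up in auto)
  finally show ?thesis .
qed

section \<open>Polynomials with prescribed exponents\<close>

text \<open>
  Exponents are treated as functions, which carry the pointwise order; the order on finitely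
  supported functions is lexicographic.
\<close>

definition expo :: "('n::finite \<Rightarrow> nat) \<Rightarrow> 'n \<Rightarrow>\<^sub>0 nat"
  where "expo w = Abs_poly_mapping w"

definition mono_of :: "('n::finite \<Rightarrow> nat) \<Rightarrow> ('n, 'k::field) mpoly"
  where "mono_of w = Poly_Mapping.single (expo w) 1"

definition span_of :: "('n::finite \<Rightarrow> nat) set \<Rightarrow> ('n, 'k::field) mpoly set"
  where "span_of A = {p. \<forall>e\<in>Poly_Mapping.keys p. Poly_Mapping.lookup e \<in> A}"

definition part :: "('n::finite \<Rightarrow> nat) set \<Rightarrow> ('n, 'k::field) mpoly \<Rightarrow> ('n, 'k) mpoly"
  where "part A p = Poly_Mapping.mapp (\<lambda>e c. if Poly_Mapping.lookup e \<in> A then c else 0) p"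

definition degree_set :: "('n \<Rightarrow> int) \<Rightarrow> ('n \<Rightarrow> nat) set"
  where "degree_set a = {z. \<forall>i. int (z i) = a i}"

text \<open>
  The exponents of the monomials in the prime ideal generated by the variables in \<open>F\<close>.
\<close>

definition supported_in :: "'n set \<Rightarrow> ('n \<Rightarrow> nat) set"
  where "supported_in F = {e. \<exists>i\<in>F. e i \<noteq> 0}"

lemma lookup_expo [simp]: "Poly_Mapping.lookup (expo w) = w"
  by (simp add: expo_def)

lemma expo_lookup [simp]: "expo (Poly_Mapping.lookup e) = e"
  by (rule poly_mapping_eqI) simp

lemma expo_eq_iff [simp]: "expo w = expo z \<longleftrightarrow> w = z"
  by (metis lookup_expo)

lemma expo_add: "expo (\<lambda>i. w i + e i) = expo w + expo e"
  by (rule poly_mapping_eqI) (simp add: lookup_add)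

lemma mono_of_eq_iff [simp]: "mono_of w = mono_of z \<longleftrightarrow> w = z"
  by (metis keys_single mono_of_def expo_eq_iff singleton_inject zero_neq_one)

lemma mono_of_mult: "mono_of w * mono_of e = mono_of (\<lambda>i. w i + e i)"
  by (simp add: mono_of_def mult_single expo_add)

lemma mono_of_zero: "(mono_of (\<lambda>_. 0) :: ('n::finite, 'k::field) mpoly) = 1"
proof -
  have "expo (\<lambda>_::'n. 0) = 0" by (rule poly_mapping_eqI) simp
  then show ?thesis by (simp add: mono_of_def)
qed

lemma monomial_iff: "monomial u \<longleftrightarrow> (\<exists>w. u = mono_of w)"
  unfolding monomial_def mono_of_def by (metis expo_lookup)

lemma span_of_iff: "p \<in> span_of A \<longleftrightarrow> (\<forall>w. w \<notin> A \<longrightarrow> Poly_Mapping.lookup p (expo w) = 0)"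
  unfolding span_of_def mem_Collect_eq
  by (metis expo_lookup in_keys_iff lookup_expo)

lemma span_of_mono: "A \<subseteq> B \<Longrightarrow> span_of A \<subseteq> span_of B"
  by (auto simp: span_of_def)

lemma span_of_UNIV [simp]: "span_of UNIV = UNIV"
  by (auto simp: span_of_def)

lemma span_of_empty: "span_of {} = {0}"
  by (auto simp: span_of_def)

lemma span_of_Int: "span_of (A \<inter> B) = span_of A \<inter> span_of B"
  by (auto simp: span_of_def)

lemma span_of_0 [simp]: "0 \<in> span_of A"
  by (simp add: span_of_def)

lemma span_of_add: "p \<in> span_of A \<Longrightarrow> q \<in> span_of A \<Longrightarrow> p + q \<in> span_of A"
  by (simp add: span_of_iff lookup_add)

lemma span_of_uminus: "p \<in> span_of A \<Longrightarrow> - p \<in> span_of A"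
  by (simp add: span_of_iff)

lemma span_of_diff: "p \<in> span_of A \<Longrightarrow> q \<in> span_of A \<Longrightarrow> p - q \<in> span_of A"
  by (simp add: span_of_iff lookup_minus)

lemma span_of_sum: "(\<And>a. a \<in> T \<Longrightarrow> q a \<in> span_of A) \<Longrightarrow> sum q T \<in> span_of A"
  by (induction T rule: infinite_finite_induct) (auto intro: span_of_add)

lemma mono_of_in_span_of [simp]: "mono_of w \<in> span_of A \<longleftrightarrow> w \<in> A"
  by (simp add: span_of_def mono_of_def)

lemma span_of_subset_iff: "(span_of A :: ('n::finite, 'k::field) mpoly set) \<subseteq> span_of B \<longleftrightarrow> A \<subseteq> B"
proof
  assume "(span_of A :: ('n, 'k) mpoly set) \<subseteq> span_of B"
  then show "A \<subseteq> B" by (metis mono_of_in_span_of subset_iff)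
qed (rule span_of_mono)

lemma span_of_mult:
  assumes "\<And>z e. z \<in> A \<Longrightarrow> e \<in> B \<Longrightarrow> (\<lambda>i. e i + z i) \<in> C" "s \<in> span_of B" "p \<in> span_of A"
  shows "s * p \<in> span_of C"
  unfolding span_of_def
proof safe
  fix k assume "k \<in> Poly_Mapping.keys (s * p)"
  then obtain e z where "e \<in> Poly_Mapping.keys s" "z \<in> Poly_Mapping.keys p" "k = e + z"
    using keys_mult[of s p] by blast
  moreover have "Poly_Mapping.lookup (e + z) = (\<lambda>i. Poly_Mapping.lookup e i + Poly_Mapping.lookup z i)"
    by (auto simp: lookup_add)
  ultimately show "Poly_Mapping.lookup k \<in> C" using assms by (auto simp: span_of_def)
qed

lemma span_of_smult: "up_closed A \<Longrightarrow> p \<in> span_of A \<Longrightarrow> s * p \<in> span_of A"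
  by (rule span_of_mult[where A = A and B = UNIV]) (auto simp: up_closed_def le_fun_def)

lemma lookup_part:
  "Poly_Mapping.lookup (part A p) e = (if Poly_Mapping.lookup e \<in> A then Poly_Mapping.lookup p e else 0)"
  by (simp add: part_def lookup_mapp when_def in_keys_iff)

lemma part_in_span_of: "p \<in> span_of B \<Longrightarrow> part A p \<in> span_of (A \<inter> B)"
  by (auto simp: span_of_iff lookup_part)

lemma diff_part_in_span_of: "p \<in> span_of B \<Longrightarrow> p - part A p \<in> span_of (B - A)"
  by (auto simp: span_of_iff lookup_part lookup_minus)

lemma poly_sum_singles:
  "p = (\<Sum>e\<in>Poly_Mapping.keys p. Poly_Mapping.single e (Poly_Mapping.lookup p e))"
proof (rule poly_mapping_eqI)
  fix k
  show "Poly_Mapping.lookup p k = Poly_Mapping.lookup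
    (\<Sum>e\<in>Poly_Mapping.keys p. Poly_Mapping.single e (Poly_Mapping.lookup p e)) k"
    by (auto simp: lookup_sum lookup_single when_def in_keys_iff sum.delta)
qed

lemma span_of_induct [consumes 1, case_names zero add single]:
  assumes "p \<in> span_of A" and "P 0"
    and "\<And>p q. P p \<Longrightarrow> P q \<Longrightarrow> P (p + q)"
    and "\<And>w c. w \<in> A \<Longrightarrow> P (Poly_Mapping.single (expo w) c)"
  shows "P p"
proof -
  have "P (\<Sum>e\<in>T. Poly_Mapping.single e (Poly_Mapping.lookup p e))"
    if "finite T" "T \<subseteq> Poly_Mapping.keys p" for T
    using that
  proof (induction T)
    case (insert e T)
    then have "P (Poly_Mapping.single (expo (Poly_Mapping.lookup e)) (Poly_Mapping.lookup p e))"
      using assms(1) by (intro assms(4)) (auto simp: span_of_def)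
    then show ?case using insert assms(3) by simp
  qed (simp add: assms(2))
  from this[of "Poly_Mapping.keys p"] show ?thesis by (simp flip: poly_sum_singles)
qed

lemma single_eq_mult_mono_of:
  "Poly_Mapping.single (expo w) c = Poly_Mapping.single 0 c * mono_of w"
  by (simp add: mono_of_def mult_single)

lemma lookup_single_mult:
  fixes p :: "('n::finite, 'k::field) mpoly"
  shows "Poly_Mapping.lookup (Poly_Mapping.single a c * p) (a + e) = c * Poly_Mapping.lookup p e"
proof -
  have "Poly_Mapping.single a c * p =
      (\<Sum>e\<in>Poly_Mapping.keys p. Poly_Mapping.single (a + e) (c * Poly_Mapping.lookup p e))"
    by (subst poly_sum_singles[of p]) (simp add: sum_distrib_left mult_single)
  then show ?thesis
    by (auto simp: lookup_sum lookup_single when_def in_keys_iff sum.delta)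
qed

lemma keys_single_mult:
  fixes p :: "('n::finite, 'k::field) mpoly"
  assumes "c \<noteq> 0"
  shows "Poly_Mapping.keys (Poly_Mapping.single a c * p) = (+) a ` Poly_Mapping.keys p"
proof
  show "Poly_Mapping.keys (Poly_Mapping.single a c * p) \<subseteq> (+) a ` Poly_Mapping.keys p"
    using keys_mult[of "Poly_Mapping.single a c" p] assms by auto
  show "(+) a ` Poly_Mapping.keys p \<subseteq> Poly_Mapping.keys (Poly_Mapping.single a c * p)"
    using assms by (auto simp: in_keys_iff lookup_single_mult)
qed

text \<open>
  Colon ideals of spans of monomials by a monomial are again such spans.
\<close>

lemma single_mult_in_span_of:
  assumes "c \<noteq> 0"
  shows "Poly_Mapping.single (expo w) c * p \<in> span_of A \<longleftrightarrow> p \<in> span_of {e. (\<lambda>i. w i + e i) \<in> A}"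
proof -
  have "Poly_Mapping.lookup (expo w + e) = (\<lambda>i. w i + Poly_Mapping.lookup e i)" for e
    by (auto simp: lookup_add)
  then show ?thesis by (simp add: span_of_def keys_single_mult[OF assms])
qed

lemma mono_of_mult_in_span_of:
  "mono_of w * p \<in> span_of A \<longleftrightarrow> p \<in> span_of {e. (\<lambda>i. w i + e i) \<in> A}"
  unfolding mono_of_def by (rule single_mult_in_span_of) simp

lemma mono_of_dvd:
  assumes "q \<in> span_of {w..}"
  shows "\<exists>p. q = mono_of w * p"
  using assms
proof (induction rule: span_of_induct)
  case zero
  show ?case by (rule exI[of _ 0]) simp
next
  case (add p q)
  then show ?case by (metis distrib_left)
next
  case (single z c)
  have "z = (\<lambda>i. w i + (z i - w i))" using single by (auto simp: le_fun_def)
  then have "mono_of z = mono_of w * mono_of (\<lambda>i. z i - w i)" by (simp add: mono_of_mult)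
  then show ?case unfolding single_eq_mult_mono_of by (metis mult.left_commute)
qed

lemma degree_set_unique: "z \<in> degree_set a \<Longrightarrow> y \<in> degree_set a \<Longrightarrow> z = y"
  unfolding degree_set_def fun_eq_iff mem_Collect_eq by (metis of_nat_eq_iff)

lemma degree_set_self: "z \<in> degree_set (\<lambda>i. int (z i))"
  by (simp add: degree_set_def)

lemma degree_set_eqD: "z \<in> degree_set a \<Longrightarrow> a = (\<lambda>i. int (z i))"
  by (auto simp: degree_set_def)

lemma homogeneous_is_single:
  assumes "q \<in> span_of (degree_set a)" "z \<in> degree_set a"
  shows "q = Poly_Mapping.single (expo z) (Poly_Mapping.lookup q (expo z))"
proof (rule poly_mapping_eqI)
  fix k
  show "Poly_Mapping.lookup q k = Poly_Mapping.lookup (Poly_Mapping.single (expo z) (Poly_Mapping.lookup q (expo z))) k"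
  proof (cases "k = expo z")
    case False
    then have "Poly_Mapping.lookup k \<noteq> z" by (metis expo_lookup)
    then have "Poly_Mapping.lookup k \<notin> degree_set a"
      using degree_set_unique[OF _ assms(2)] by blast
    then have "Poly_Mapping.lookup q k = 0" using assms(1) by (metis expo_lookup span_of_iff)
    then show ?thesis using False by (simp add: lookup_single)
  qed simp
qed

section \<open>The polynomial ring\<close>

lemma mpoly_ring_simps [simp]:
  "carrier (mpoly_ring :: ('n::finite, 'k::field) mpoly ring) = UNIV"
  "monoid.mult (mpoly_ring :: ('n, 'k) mpoly ring) = (*)"
  "one (mpoly_ring :: ('n, 'k) mpoly ring) = 1"
  "ring.zero (mpoly_ring :: ('n, 'k) mpoly ring) = 0"
  "add (mpoly_ring :: ('n, 'k) mpoly ring) = (+)"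
  by (simp_all add: ring_of_type_algebra_def)

lemma cring_mpoly_ring: "cring (mpoly_ring :: ('n::finite, 'k::field) mpoly ring)"
  by (rule cring_from_type_algebra)

lemma ring_mpoly_ring: "ring (mpoly_ring :: ('n::finite, 'k::field) mpoly ring)"
  by (rule ring_from_type_algebra)

lemma idealI_mpoly:
  fixes J :: "('n::finite, 'k::field) mpoly set"
  assumes "0 \<in> J" "\<And>p q. p \<in> J \<Longrightarrow> q \<in> J \<Longrightarrow> p + q \<in> J" "\<And>s p. p \<in> J \<Longrightarrow> s * p \<in> J"
  shows "ideal J mpoly_ring"
proof (rule idealI[OF ring_mpoly_ring])
  interpret R: ring "mpoly_ring :: ('n, 'k) mpoly ring" by (rule ring_mpoly_ring)
  have inv: "inv\<^bsub>add_monoid mpoly_ring\<^esub> p = - p" for p :: "('n, 'k) mpoly"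
    using R.minus_equality[of "- p" p] by (simp add: a_inv_def)
  have neg: "- p \<in> J" if "p \<in> J" for p using assms(3)[OF that, of "- 1"] by simp
  show "subgroup J (add_monoid mpoly_ring)"
    by unfold_locales (use assms neg inv in auto)
qed (use assms(3) in \<open>auto simp: mult.commute\<close>)

lemma ideal_mpolyD:
  fixes J :: "('n::finite, 'k::field) mpoly set"
  assumes "ideal J mpoly_ring"
  shows "0 \<in> J" "\<And>p q. p \<in> J \<Longrightarrow> q \<in> J \<Longrightarrow> p + q \<in> J" "\<And>s p. p \<in> J \<Longrightarrow> s * p \<in> J"
proof -
  interpret ideal J mpoly_ring by fact
  show "0 \<in> J" using additive_subgroup.zero_closed[OF is_additive_subgroup] by simp
  show "p + q \<in> J" if "p \<in> J" "q \<in> J" for p q using additive_subgroup.a_closed[OF is_additive_subgroup that] by simp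
  show "s * p \<in> J" if "p \<in> J" for s p using I_l_closed[OF that, of s] by simp
qed

lemma ideal_span_of: "up_closed A \<Longrightarrow> ideal (span_of A) mpoly_ring"
  by (intro idealI_mpoly span_of_0 span_of_add span_of_smult)

lemma genideal_eq_span_of:
  fixes T :: "('n::finite, 'k::field) mpoly set"
  assumes "up_closed A" "T \<subseteq> span_of A" "\<And>w. w \<in> A \<Longrightarrow> \<exists>v\<le>w. mono_of v \<in> T"
  shows "Idl\<^bsub>mpoly_ring\<^esub> T = span_of A"
proof
  interpret R: ring "mpoly_ring :: ('n, 'k) mpoly ring" by (rule ring_mpoly_ring)
  show "Idl\<^bsub>mpoly_ring\<^esub> T \<subseteq> span_of A"
    using ideal_span_of assms by (intro R.genideal_minimal) auto
  have J: "ideal (Idl\<^bsub>mpoly_ring\<^esub> T) mpoly_ring" by (rule R.genideal_ideal) simp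
  have T: "T \<subseteq> Idl\<^bsub>mpoly_ring\<^esub> T" by (rule R.genideal_self) simp
  show "span_of A \<subseteq> Idl\<^bsub>mpoly_ring\<^esub> T"
  proof
    fix p :: "('n, 'k) mpoly" assume "p \<in> span_of A"
    then show "p \<in> Idl\<^bsub>mpoly_ring\<^esub> T"
    proof (induction rule: span_of_induct)
      case zero show ?case using ideal_mpolyD[OF J] by simp
    next
      case (add p q) then show ?case using ideal_mpolyD[OF J] by simp
    next
      case (single w c)
      obtain v where v: "v \<le> w" "mono_of v \<in> T" using assms(3)[OF single] by blast
      have "w = (\<lambda>i. (w i - v i) + v i)" using v(1) by (auto simp: le_fun_def)
      then have "mono_of w = mono_of (\<lambda>i. w i - v i) * (mono_of v :: ('n, 'k) mpoly)"
        by (simp add: mono_of_mult)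
      then show ?case using v(2) T ideal_mpolyD(3)[OF J]
        by (auto simp: single_eq_mult_mono_of)
    qed
  qed
qed

section \<open>Monomial primes\<close>

lemma up_closed_supported_in: "up_closed (supported_in F)"
  by (auto simp: up_closed_def supported_in_def le_fun_def) (metis le_zero_eq neq0_conv)

lemma supported_in_subset_iff: "supported_in F \<subseteq> supported_in G \<longleftrightarrow> F \<subseteq> G"
proof
  assume FG: "supported_in F \<subseteq> supported_in G"
  show "F \<subseteq> G"
  proof
    fix i assume "i \<in> F"
    then have "(\<lambda>j. if j = i then 1 else 0) \<in> supported_in F" by (auto simp: supported_in_def)
    then have "(\<lambda>j. if j = i then 1 else 0) \<in> supported_in G" using FG by blast
    then show "i \<in> G" by (auto simp: supported_in_def split: if_splits)
  qed
qed (auto simp: supported_in_def)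

text \<open>
  The variables carry no order.  Numbering them embeds the exponents into a monoid with a
  translation-invariant linear order, which provides leading monomials.
\<close>

lemma exponent_order:
  "\<exists>k :: ('n::finite \<Rightarrow>\<^sub>0 nat) \<Rightarrow> nat \<Rightarrow>\<^sub>0 nat. inj k \<and> (\<forall>a b. k (a + b) = k a + k b)"
proof -
  obtain h :: "'n \<Rightarrow> nat" where h: "inj h"
    using finite_imp_inj_to_nat_seg[of "UNIV :: 'n set"] by auto
  define k where "k e = (\<Sum>i\<in>UNIV. Poly_Mapping.single (h i) (Poly_Mapping.lookup e i))"
    for e :: "'n \<Rightarrow>\<^sub>0 nat"
  have "Poly_Mapping.lookup (k e) (h i) = Poly_Mapping.lookup e i" for e i
    using h by (auto simp: k_def lookup_sum lookup_single when_def inj_eq)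
  then have "inj k" by (metis injI poly_mapping_eqI)
  moreover have "k (a + b) = k a + k b" for a b
    by (simp add: k_def lookup_add single_add sum.distrib)
  ultimately show ?thesis by blast
qed

text \<open>
  Drop from both factors all terms in the ideal.  The leading terms of what remains involve no
  variable of \<open>F\<close>, and their product is a term of the product.
\<close>

lemma mult_notin_span_supported_in:
  fixes p q :: "('n::finite, 'k::field) mpoly"
  assumes "p \<notin> span_of (supported_in F)" "q \<notin> span_of (supported_in F)"
  shows "p * q \<notin> span_of (supported_in F)"
proof -
  let ?P = "supported_in F"
  obtain k :: "('n \<Rightarrow>\<^sub>0 nat) \<Rightarrow> nat \<Rightarrow>\<^sub>0 nat"
    where k: "inj k" "\<And>a b. k (a + b) = k a + k b" using exponent_order by blast
  define p' where "p' = part (- ?P) p"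
  define q' where "q' = part (- ?P) q"
  have p': "p - p' \<in> span_of ?P" and q': "q - q' \<in> span_of ?P"
    using diff_part_in_span_of[of _ UNIV "- ?P"] by (auto simp: p'_def q'_def Compl_eq_Diff_UNIV[symmetric])
  have lead: "\<exists>e\<in>Poly_Mapping.keys r. \<forall>a\<in>Poly_Mapping.keys r. k a \<le> k e" if "r \<noteq> 0"
    for r :: "('n, 'k) mpoly"
  proof -
    have "finite (k ` Poly_Mapping.keys r)" "k ` Poly_Mapping.keys r \<noteq> {}" using that by auto
    from Max_in[OF this] Max_ge[OF this(1)] show ?thesis by fastforce
  qed
  have "p' \<noteq> 0" "q' \<noteq> 0" using assms p' q' by auto
  then obtain e d where e: "e \<in> Poly_Mapping.keys p'" "\<And>a. a \<in> Poly_Mapping.keys p' \<Longrightarrow> k a \<le> k e"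
    and d: "d \<in> Poly_Mapping.keys q'" "\<And>a. a \<in> Poly_Mapping.keys q' \<Longrightarrow> k a \<le> k d"
    using lead by metis
  define c where "c = Poly_Mapping.lookup p' e"
  define p'' where "p'' = p' - Poly_Mapping.single e c"
  have keys'': "Poly_Mapping.keys p'' \<subseteq> Poly_Mapping.keys p' - {e}"
    by (auto simp: p''_def c_def in_keys_iff lookup_minus lookup_single when_def split: if_splits)
  have "e + d \<notin> Poly_Mapping.keys (p'' * q')"
  proof
    assume "e + d \<in> Poly_Mapping.keys (p'' * q')"
    then obtain a b where ab: "a \<in> Poly_Mapping.keys p''" "b \<in> Poly_Mapping.keys q'" "e + d = a + b"
      using keys_mult[of p'' q'] by blast
    have "a \<noteq> e" "k a \<le> k e" "k b \<le> k d" using ab keys'' e d by auto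
    then have "k a < k e" using k(1) by (simp add: inj_eq order.not_eq_order_implies_strict)
    then have "k a + k b < k e + k d" using \<open>k b \<le> k d\<close> by (rule add_less_le_mono)
    then show False using arg_cong[OF ab(3), of k] k(2) by simp
  qed
  then have "Poly_Mapping.lookup (p' * q') (e + d) = c * Poly_Mapping.lookup q' d"
    by (subst (1) diff_add_cancel[of p' "Poly_Mapping.single e c", symmetric])
      (simp add: distrib_right lookup_add lookup_single_mult in_keys_iff flip: p''_def)
  then have "Poly_Mapping.lookup (p' * q') (e + d) \<noteq> 0" using e(1) d(1) by (simp add: c_def in_keys_iff)
  moreover have "Poly_Mapping.lookup (e + d) \<notin> ?P"
  proof -
    have "Poly_Mapping.lookup e \<notin> ?P" "Poly_Mapping.lookup d \<notin> ?P"
      using e(1) d(1) by (auto simp: p'_def q'_def in_keys_iff lookup_part split: if_splits)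
    then show ?thesis by (simp add: supported_in_def lookup_add)
  qed
  ultimately have notin: "p' * q' \<notin> span_of ?P" by (auto simp: span_of_def in_keys_iff)
  have "p * q = p' * q' + ((p - p') * q + p' * (q - q'))" by (simp add: algebra_simps)
  moreover have "(p - p') * q + p' * (q - q') \<in> span_of ?P"
    using span_of_smult[OF up_closed_supported_in q', of p'] span_of_smult[OF up_closed_supported_in p', of q]
    by (auto simp: mult.commute intro: span_of_add)
  ultimately show ?thesis
    using notin span_of_diff[of "p * q" ?P "(p - p') * q + p' * (q - q')"] by auto
qed

lemma primeideal_span_supported_in:
  "primeideal (span_of (supported_in F) :: ('n::finite, 'k::field) mpoly set) mpoly_ring"
proof (rule primeidealI)
  show "ideal (span_of (supported_in F) :: ('n, 'k) mpoly set) mpoly_ring"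
    by (rule ideal_span_of[OF up_closed_supported_in])
  show "cring (mpoly_ring :: ('n, 'k) mpoly ring)" by (rule cring_mpoly_ring)
  have "mono_of (\<lambda>_. 0) \<notin> (span_of (supported_in F) :: ('n, 'k) mpoly set)"
    unfolding mono_of_in_span_of by (simp add: supported_in_def)
  then show "carrier mpoly_ring \<noteq> (span_of (supported_in F) :: ('n, 'k) mpoly set)"
    unfolding mpoly_ring_simps by blast
qed (use mult_notin_span_supported_in in auto)

text \<open>
  A monomial in the prime is a product of variables, so one of them lies in the prime.
\<close>

lemma prime_span_of_is_supported_in:
  assumes "primeideal (span_of U :: ('n::finite, 'k::field) mpoly set) mpoly_ring" "up_closed U"
  shows "\<exists>F. U = supported_in F"
proof -
  interpret primeideal "span_of U :: ('n, 'k) mpoly set" mpoly_ring by fact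
  let ?x = "\<lambda>i j. if j = i then 1 else 0 :: nat"
  define F where "F = {i. ?x i \<in> U}"
  have "e \<in> U" if e: "e \<in> supported_in F" for e
  proof -
    obtain i where "i \<in> F" "e i \<noteq> 0" using e unfolding supported_in_def by blast
    then have "?x i \<in> U" "?x i \<le> e" by (auto simp: F_def le_fun_def)
    then show ?thesis using assms(2) up_closedD by blast
  qed
  moreover have "e \<in> supported_in F" if "e \<in> U" for e
    using that
  proof (induction "sum e UNIV" arbitrary: e)
    case 0
    then have "e = (\<lambda>_. 0)" by auto
    then have "U = UNIV" using 0 assms(2) by (auto simp: up_closed_def le_fun_def)
    then show ?case using I_notcarr by simp
  next
    case (Suc n)
    obtain i where i: "e i \<noteq> 0" using Suc(2) by (metis nat.distinct(1) sum.neutral)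
    define e' where "e' = e(i := e i - 1)"
    have sum: "sum e UNIV = Suc (sum e' UNIV)"
      using i by (subst (1 2) sum.remove[of UNIV i]) (auto simp: e'_def)
    have "e = (\<lambda>j. ?x i j + e' j)" using i by (auto simp: e'_def)
    then have "mono_of (?x i) * mono_of e' = (mono_of e :: ('n, 'k) mpoly)"
      by (simp add: mono_of_mult)
    then have "mono_of (?x i) * mono_of e' \<in> (span_of U :: ('n, 'k) mpoly set)"
      using Suc(3) by simp
    then have "?x i \<in> U \<or> e' \<in> U"
      using I_prime[of "mono_of (?x i)" "mono_of e'"] by simp
    then show ?case
    proof
      assume "?x i \<in> U" then show ?thesis using i by (auto simp: F_def supported_in_def)
    next
      assume "e' \<in> U"
      then have "e' \<in> supported_in F" using Suc sum by (intro Suc(1)) auto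
      then obtain j where "j \<in> F" "e' j \<noteq> 0" unfolding supported_in_def by blast
      then have "j \<in> F" "e j \<noteq> 0" using i by (auto simp: e'_def split: if_splits)
      then show ?thesis unfolding supported_in_def by blast
    qed
  qed
  ultimately have "U = supported_in F" by blast
  then show ?thesis by blast
qed

lemma max_ideal_eq: "max_ideal = (span_of (supported_in UNIV) :: ('n::finite, 'k::field) mpoly set)"
  unfolding max_ideal_def
proof (rule genideal_eq_span_of[OF up_closed_supported_in])
  have var: "var i = (mono_of (\<lambda>j. if j = i then 1 else 0) :: ('n, 'k) mpoly)" for i
  proof -
    have "Poly_Mapping.single i 1 = expo (\<lambda>j. if j = i then 1 else 0 :: nat)"
      by (rule poly_mapping_eqI) (simp add: lookup_single when_def)
    then show ?thesis by (simp add: var_def mono_of_def)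
  qed
  show "range var \<subseteq> (span_of (supported_in UNIV) :: ('n, 'k) mpoly set)"
    by (auto simp: var supported_in_def)
  fix w :: "'n \<Rightarrow> nat" assume "w \<in> supported_in UNIV"
  then obtain i where "w i \<noteq> 0" by (auto simp: supported_in_def)
  then have "(\<lambda>j. if j = i then 1 else 0) \<le> w" by (auto simp: le_fun_def)
  then show "\<exists>v\<le>w. mono_of v \<in> (range var :: ('n, 'k) mpoly set)" using var by (metis rangeI)
qed

section \<open>Monomial subquotients\<close>

lemma component_poly_module: "component poly_module a = span_of (degree_set a)"
  by (simp add: poly_module_def span_of_def degree_set_def)

text \<open>
  The modules that occur (\<open>S\<close>, \<open>S/I\<close>, the members of a filtration of \<open>S/I\<close> and their successive
  quotients, \<open>S/P\<close>, iterated quotients of \<open>S/I\<close>) are all of the form \<open>J/I\<close> with monomial ideals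
  \<open>I \<subseteq> J\<close>, but their elements are polynomials, cosets, or cosets of cosets.  The locale
  describes such a module, with exponent sets \<open>A\<close> of \<open>I\<close> and \<open>B\<close> of \<open>J\<close>, by the
  projection from \<open>J\<close>, so that all of them can be treated alike.
\<close>

locale monomial_subquotient =
  fixes N :: "(('n::finite, 'k::field) mpoly, 'm, 'n) mgmodule" (structure)
    and proj :: "('n, 'k) mpoly \<Rightarrow> 'm"
    and B A :: "('n \<Rightarrow> nat) set"
  assumes up_closed_A: "up_closed A" and up_closed_B: "up_closed B" and A_le_B: "A \<subseteq> B"
    and carrier_eq: "carrier N = proj ` span_of B"
    and zero_eq: "\<zero> = proj 0"
    and proj_add: "\<And>p q. p \<in> span_of B \<Longrightarrow> q \<in> span_of B \<Longrightarrow> proj p \<oplus> proj q = proj (p + q)"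
    and proj_smult: "\<And>s p. p \<in> span_of B \<Longrightarrow> s \<odot> proj p = proj (s * p)"
    and proj_eq_iff: "\<And>p q. p \<in> span_of B \<Longrightarrow> q \<in> span_of B \<Longrightarrow>
      proj p = proj q \<longleftrightarrow> p - q \<in> span_of A"
    and component_eq: "\<And>a. component N a = proj ` span_of (degree_set a \<inter> B)"
begin

lemma proj_closed [intro, simp]: "p \<in> span_of B \<Longrightarrow> proj p \<in> carrier N"
  by (simp add: carrier_eq)

lemma proj_eq_zero_iff: "p \<in> span_of B \<Longrightarrow> proj p = \<zero> \<longleftrightarrow> p \<in> span_of A"
  using proj_eq_iff[of p 0] by (simp add: zero_eq)

lemma module_axiom: "Module.module (mpoly_ring :: ('n, 'k) mpoly ring) N"
proof (rule moduleI)
  have B: "\<And>p q. p \<in> span_of B \<Longrightarrow> q \<in> span_of B \<Longrightarrow> p + q \<in> (span_of B :: ('n, 'k) mpoly set)"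
    "\<And>s p. p \<in> span_of B \<Longrightarrow> s * p \<in> (span_of B :: ('n, 'k) mpoly set)"
    using up_closed_B span_of_add span_of_smult by blast+
  show "abelian_group N"
  proof (rule abelian_groupI)
    fix x assume "x \<in> carrier N"
    then obtain p where p: "p \<in> span_of B" "x = proj p" by (auto simp: carrier_eq)
    have "proj (- p) \<oplus> x = \<zero>" "proj (- p) \<in> carrier N"
      using p by (auto simp: proj_add zero_eq carrier_eq span_of_uminus)
    then show "\<exists>y\<in>carrier N. y \<oplus> x = \<zero>" by blast
  qed (auto simp: carrier_eq zero_eq proj_add B add_ac)
qed (auto simp: carrier_eq proj_add proj_smult up_closed_B span_of_add span_of_smult cring_mpoly_ring
  algebra_simps)

sublocale Module.module "mpoly_ring :: ('n, 'k) mpoly ring" N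
  by (rule module_axiom)

lemma minus_proj: "p \<in> span_of B \<Longrightarrow> \<ominus> proj p = proj (- p)"
  by (rule minus_equality) (auto simp: proj_add zero_eq span_of_uminus)

lemma finsum_proj:
  assumes "abelian_monoid L" "add L = add N" "\<zero>\<^bsub>L\<^esub> = \<zero>" "finite T"
    and "\<And>t. t \<in> T \<Longrightarrow> q t \<in> span_of B" "\<And>t. t \<in> T \<Longrightarrow> proj (q t) \<in> carrier L"
  shows "finsum L (\<lambda>t. proj (q t)) T = proj (sum q T)"
proof -
  interpret L: abelian_monoid L by fact
  show ?thesis
    using assms(4-6)
  proof (induction T)
    case empty
    show ?case using assms(3) by (simp add: zero_eq)
  next
    case (insert t T)
    have "finsum L (\<lambda>t. proj (q t)) (insert t T) = proj (q t) \<oplus>\<^bsub>L\<^esub> finsum L (\<lambda>t. proj (q t)) T"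
      using insert by (intro L.finsum_insert) auto
    also have "\<dots> = proj (q t) \<oplus> proj (sum q T)" using insert assms(2) by simp
    also have "\<dots> = proj (sum q (insert t T))"
      using insert by (simp add: proj_add span_of_sum)
    finally show ?case .
  qed
qed

lemma lookup_homogeneous_sum:
  assumes "finite T" "\<And>a. a \<in> T \<Longrightarrow> q a \<in> span_of (degree_set a)"
  shows "Poly_Mapping.lookup (sum q T) (expo w) =
    (if (\<lambda>i. int (w i)) \<in> T then Poly_Mapping.lookup (q (\<lambda>i. int (w i))) (expo w) else 0)"
proof -
  have "Poly_Mapping.lookup (q a) (expo w) = 0" if "a \<in> T" "a \<noteq> (\<lambda>i. int (w i))" for a
    using assms(2)[OF that(1)] that(2) degree_set_eqD unfolding span_of_iff by blast
  then have "(\<Sum>a\<in>T. Poly_Mapping.lookup (q a) (expo w)) =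
      (\<Sum>a\<in>T. if a = (\<lambda>i. int (w i)) then Poly_Mapping.lookup (q a) (expo w) else 0)"
    by (intro sum.cong) auto
  then show ?thesis using assms(1) by (simp add: lookup_sum)
qed

text \<open>
  The homogeneous parts of a representing polynomial give a decomposition.  In another one, each
  part is represented by a polynomial of the same degree, and comparing coefficients outside \<open>A\<close>
  shows that it is the same element.
\<close>

lemma direct_sum_axiom:
  assumes "x \<in> carrier N"
  shows "\<exists>!f. (\<forall>a. f a \<in> component N a) \<and> finite {a. f a \<noteq> \<zero>} \<and>
    x = (\<Oplus>a\<in>{a. f a \<noteq> \<zero>}. f a)"
proof -
  obtain p where p: "p \<in> span_of B" "x = proj p" using assms by (auto simp: carrier_eq)
  define f where "f a = proj (part (degree_set a) p)" for a
  have part: "part (degree_set a) p \<in> span_of (degree_set a \<inter> B)" for a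
    using p(1) by (rule part_in_span_of)
  have partB: "part (degree_set a) p \<in> span_of B" for a
    using part[of a] by (simp add: span_of_Int)
  have fz: "f a = \<zero> \<longleftrightarrow> part (degree_set a) p \<in> span_of A" for a
    unfolding f_def using partB by (rule proj_eq_zero_iff)
  show ?thesis
  proof (rule ex1I[of _ f], intro conjI allI)
    show "f a \<in> component N a" for a using part by (simp add: f_def component_eq)
    have "{a. f a \<noteq> \<zero>} \<subseteq> (\<lambda>e i. int (Poly_Mapping.lookup e i)) ` Poly_Mapping.keys p"
    proof
      fix a assume "a \<in> {a. f a \<noteq> \<zero>}"
      then have "part (degree_set a) p \<notin> span_of A" using fz[of a] by simp
      then have "part (degree_set a) p \<noteq> 0" by (metis span_of_0)
      then have "Poly_Mapping.keys (part (degree_set a) p) \<noteq> {}" by simp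
      then obtain e where "e \<in> Poly_Mapping.keys (part (degree_set a) p)" by blast
      then have "e \<in> Poly_Mapping.keys p" "Poly_Mapping.lookup e \<in> degree_set a"
        by (auto simp: in_keys_iff lookup_part split: if_splits)
      then show "a \<in> (\<lambda>e i. int (Poly_Mapping.lookup e i)) ` Poly_Mapping.keys p"
        using degree_set_eqD by blast
    qed
    then show fin: "finite {a. f a \<noteq> \<zero>}" by (rule finite_subset) simp
    have sumB: "(\<Sum>a\<in>{a. f a \<noteq> \<zero>}. part (degree_set a) p) \<in> span_of B"
      using partB by (intro span_of_sum)
    have "p - (\<Sum>a\<in>{a. f a \<noteq> \<zero>}. part (degree_set a) p) \<in> span_of A"
      unfolding span_of_iff
    proof safe
      fix w assume w: "w \<notin> A"
      let ?a = "\<lambda>i. int (w i)"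
      have "Poly_Mapping.lookup p (expo w) = 0" if "f ?a = \<zero>"
      proof -
        have "Poly_Mapping.lookup (part (degree_set ?a) p) (expo w) = 0"
          using that w fz[of ?a] by (simp add: span_of_iff)
        then show ?thesis by (simp add: lookup_part degree_set_self)
      qed
      then show "Poly_Mapping.lookup (p - (\<Sum>a\<in>{a. f a \<noteq> \<zero>}. part (degree_set a) p)) (expo w) = 0"
        using fin part degree_set_self[of w]
        by (auto simp: lookup_minus lookup_homogeneous_sum span_of_Int lookup_part)
    qed
    then have "x = proj (\<Sum>a\<in>{a. f a \<noteq> \<zero>}. part (degree_set a) p)"
      using p sumB proj_eq_iff by blast
    also have "\<dots> = (\<Oplus>a\<in>{a. f a \<noteq> \<zero>}. f a)"
      unfolding f_def using fin partB
      by (intro finsum_proj[symmetric]) (auto simp: f_def abelian_monoid_axioms)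
    finally show "x = (\<Oplus>a\<in>{a. f a \<noteq> \<zero>}. f a)" .
  next
    fix g assume g: "(\<forall>a. g a \<in> component N a) \<and> finite {a. g a \<noteq> \<zero>} \<and>
      x = (\<Oplus>a\<in>{a. g a \<noteq> \<zero>}. g a)"
    then have "\<forall>a. \<exists>q. q \<in> span_of (degree_set a \<inter> B) \<and> g a = proj q"
      by (auto simp: component_eq)
    then obtain q where q: "\<And>a. q a \<in> span_of (degree_set a \<inter> B)" "\<And>a. g a = proj (q a)" by metis
    then have qB: "q a \<in> span_of B" and qd: "q a \<in> span_of (degree_set a)" for a
      by (auto simp: span_of_Int)
    let ?T = "{a. g a \<noteq> \<zero>}"
    have fin: "finite ?T" using g by blast
    have gz: "g a = \<zero> \<longleftrightarrow> q a \<in> span_of A" for a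
      unfolding q(2) using qB by (rule proj_eq_zero_iff)
    have "x = (\<Oplus>a\<in>?T. g a)" using g by blast
    also have "\<dots> = proj (sum q ?T)"
      unfolding q(2) using fin qB by (intro finsum_proj) (auto simp: q(2) abelian_monoid_axioms)
    finally have diff: "p - sum q ?T \<in> span_of A"
      using p qB proj_eq_iff span_of_sum by metis
    show "g = f"
    proof
      fix a
      have "q a - part (degree_set a) p \<in> span_of A"
        unfolding span_of_iff
      proof safe
        fix w assume w: "w \<notin> A"
        show "Poly_Mapping.lookup (q a - part (degree_set a) p) (expo w) = 0"
        proof (cases "w \<in> degree_set a")
          case True
          then have a: "a = (\<lambda>i. int (w i))" by (rule degree_set_eqD)
          have "Poly_Mapping.lookup (p - sum q ?T) (expo w) = 0"
            using diff w unfolding span_of_iff by blast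
          then have "Poly_Mapping.lookup p (expo w) =
              (if g a \<noteq> \<zero> then Poly_Mapping.lookup (q a) (expo w) else 0)"
            using lookup_homogeneous_sum[OF fin qd, of w] by (simp add: lookup_minus a)
          moreover have "Poly_Mapping.lookup (q a) (expo w) = 0" if "g a = \<zero>"
            using that w unfolding gz span_of_iff by blast
          ultimately show ?thesis using True by (auto simp: lookup_minus lookup_part split: if_splits)
        next
          case False
          then have "Poly_Mapping.lookup (q a) (expo w) = 0" using qd[of a] unfolding span_of_iff by blast
          then show ?thesis using False by (simp add: lookup_minus lookup_part)
        qed
      qed
      then show "g a = f a" unfolding q(2) f_def using proj_eq_iff qB partB by blast
    qed
  qed
qed

lemma multigraded: "multigraded_module N"
proof (intro multigraded_module.intro multigraded_module_axioms.intro module_axiom direct_sum_axiom)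
  fix a
  show "subgroup (component N a) (add_monoid N)"
  proof
    show "component N a \<subseteq> carrier (add_monoid N)"
      using span_of_Int by (auto simp: component_eq carrier_eq)
    show "\<one>\<^bsub>add_monoid N\<^esub> \<in> component N a" by (simp add: component_eq zero_eq)
  next
    fix x y assume "x \<in> component N a" "y \<in> component N a"
    then obtain p q where "p \<in> span_of (degree_set a \<inter> B)" "x = proj p"
      "q \<in> span_of (degree_set a \<inter> B)" "y = proj q" unfolding component_eq by blast
    then show "x \<otimes>\<^bsub>add_monoid N\<^esub> y \<in> component N a"
      by (auto simp: component_eq proj_add span_of_Int intro!: imageI span_of_add)
  next
    fix x assume "x \<in> component N a"
    then obtain p where "p \<in> span_of (degree_set a \<inter> B)" "x = proj p" unfolding component_eq by blast
    then have "\<ominus> x \<in> component N a"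
      by (auto simp: component_eq minus_proj span_of_Int intro!: imageI span_of_uminus)
    then show "inv\<^bsub>add_monoid N\<^esub> x \<in> component N a" by (simp add: a_inv_def)
  qed
next
  fix s :: "('n, 'k) mpoly" and b x a
  assume s: "s \<in> component poly_module b" and "x \<in> component N a"
  then obtain p where p: "p \<in> span_of (degree_set a \<inter> B)" "x = proj p" unfolding component_eq by blast
  have "s * p \<in> span_of (degree_set (\<lambda>i. b i + a i))"
    using s p(1) by (intro span_of_mult[of "degree_set a" "degree_set b"])
      (auto simp: component_poly_module span_of_Int degree_set_def)
  moreover have "s * p \<in> span_of B" using p(1) span_of_smult[OF up_closed_B] by (auto simp: span_of_Int)
  ultimately show "s \<odot> x \<in> component N (\<lambda>i. b i + a i)"
    using p by (auto simp: component_eq proj_smult span_of_Int)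
qed

lemma mem_image_span_iff:
  assumes "A \<subseteq> C" "C \<subseteq> B" "p \<in> span_of B"
  shows "proj p \<in> proj ` span_of C \<longleftrightarrow> p \<in> span_of C"
proof
  assume "proj p \<in> proj ` span_of C"
  then obtain q where q: "q \<in> span_of C" "proj p = proj q" by blast
  then have "p - q \<in> span_of C"
    using proj_eq_iff[of p q] assms span_of_mono by blast
  from span_of_add[OF this q(1)] show "p \<in> span_of C" by simp
qed (rule imageI)

lemma image_span_subset_iff:
  assumes "A \<subseteq> D" "C \<subseteq> B" "D \<subseteq> B"
  shows "proj ` span_of C \<subseteq> proj ` span_of D \<longleftrightarrow> C \<subseteq> D"
proof
  assume sub: "proj ` span_of C \<subseteq> proj ` span_of D"
  show "C \<subseteq> D"
  proof
    fix w assume "w \<in> C"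
    then have "proj (mono_of w) \<in> proj ` span_of D" "w \<in> B" using sub assms by auto
    then show "w \<in> D" using mem_image_span_iff[OF assms(1,3), of "mono_of w"] by simp
  qed
qed (use span_of_mono in blast)

lemma restrict:
  assumes "up_closed C" "A \<subseteq> C" "C \<subseteq> B"
  shows "monomial_subquotient (restrict_module N (proj ` span_of C)) proj C A"
proof -
  have CB: "p \<in> span_of B" if "p \<in> span_of C" for p :: "('n, 'k) mpoly"
    using that span_of_mono[OF assms(3)] by blast
  show ?thesis
  proof
    show "component (restrict_module N (proj ` span_of C)) a = proj ` span_of (degree_set a \<inter> C)" for a
    proof -
      have "proj ` span_of (degree_set a \<inter> B) \<inter> proj ` span_of C = proj ` span_of (degree_set a \<inter> C)"
      proof (intro Set.set_eqI iffI)
        fix x assume "x \<in> proj ` span_of (degree_set a \<inter> B) \<inter> proj ` span_of C"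
        then obtain p where "p \<in> span_of (degree_set a \<inter> B)" "x = proj p" "proj p \<in> proj ` span_of C" by auto
        then show "x \<in> proj ` span_of (degree_set a \<inter> C)"
          using mem_image_span_iff[OF assms(2,3), of p] by (auto simp: span_of_Int)
      next
        fix x assume "x \<in> proj ` span_of (degree_set a \<inter> C)"
        then show "x \<in> proj ` span_of (degree_set a \<inter> B) \<inter> proj ` span_of C"
          using CB by (auto simp: span_of_Int)
      qed
      then show ?thesis by (simp add: restrict_module_def component_eq)
    qed
  qed (use assms up_closed_A CB in
    \<open>auto simp: restrict_module_def zero_eq proj_add proj_smult proj_eq_iff\<close>)
qed

lemma coset_eq:
  assumes "C \<subseteq> B" "p \<in> span_of B"
  shows "proj ` span_of C +>\<^bsub>N\<^esub> proj p = (\<lambda>c. proj (c + p)) ` span_of C"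
proof -
  have "c \<in> span_of B" if "c \<in> span_of C" for c :: "('n, 'k) mpoly"
    using that span_of_mono[OF assms(1)] by blast
  then show ?thesis using assms(2) by (auto simp: a_r_coset_def' proj_add)
qed

lemma quotient:
  assumes "up_closed C" "A \<subseteq> C" "C \<subseteq> B"
  shows "monomial_subquotient (quotient_module N (proj ` span_of C))
    (\<lambda>p. proj ` span_of C +>\<^bsub>N\<^esub> proj p) B C"
proof
  let ?H = "proj ` span_of C"
  have CB: "c \<in> span_of B" if "c \<in> span_of C" for c :: "('n, 'k) mpoly"
    using that span_of_mono[OF assms(3)] by blast
  have coset: "?H +>\<^bsub>N\<^esub> proj p = (\<lambda>c. proj (c + p)) ` span_of C" if "p \<in> span_of B" for p
    using coset_eq[OF assms(3) that] .
  show "carrier (quotient_module N ?H) = (\<lambda>p. ?H +>\<^bsub>N\<^esub> proj p) ` span_of B"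
    by (auto simp: quotient_module_def A_RCOSETS_def' carrier_eq)
  show "\<zero>\<^bsub>quotient_module N ?H\<^esub> = ?H +>\<^bsub>N\<^esub> proj 0"
    by (simp add: quotient_module_def coset)
  show "component (quotient_module N ?H) a = (\<lambda>p. ?H +>\<^bsub>N\<^esub> proj p) ` span_of (degree_set a \<inter> B)" for a
    by (auto simp: quotient_module_def component_eq)
  show iff: "?H +>\<^bsub>N\<^esub> proj p = ?H +>\<^bsub>N\<^esub> proj q \<longleftrightarrow> p - q \<in> span_of C"
    if p: "p \<in> span_of B" and q: "q \<in> span_of B" for p q
  proof
    assume eq: "?H +>\<^bsub>N\<^esub> proj p = ?H +>\<^bsub>N\<^esub> proj q"
    have "proj p \<in> ?H +>\<^bsub>N\<^esub> proj p" unfolding coset[OF p] by (rule image_eqI[of _ _ 0]) auto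
    then obtain c where c: "c \<in> span_of C" "proj p = proj (c + q)"
      unfolding eq coset[OF q] by blast
    then have "p - (c + q) \<in> span_of C"
      using proj_eq_iff[of p "c + q"] p q CB span_of_add span_of_mono[OF assms(2)] by blast
    from span_of_add[OF this c(1)] show "p - q \<in> span_of C" by simp
  next
    assume pq: "p - q \<in> span_of C"
    have "(\<lambda>c. c + p) ` span_of C = (\<lambda>c. c + q) ` span_of C"
    proof (intro Set.set_eqI iffI)
      fix x assume "x \<in> (\<lambda>c. c + p) ` span_of C"
      then obtain c where "c \<in> span_of C" "x = (c + (p - q)) + q" by auto
      then show "x \<in> (\<lambda>c. c + q) ` span_of C" using span_of_add[OF _ pq] by blast
    next
      fix x assume "x \<in> (\<lambda>c. c + q) ` span_of C"
      then obtain c where "c \<in> span_of C" "x = (c - (p - q)) + p" by auto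
      then show "x \<in> (\<lambda>c. c + p) ` span_of C" using span_of_diff[OF _ pq] by blast
    qed
    then have "proj ` (\<lambda>c. c + p) ` span_of C = proj ` (\<lambda>c. c + q) ` span_of C" by simp
    then show "?H +>\<^bsub>N\<^esub> proj p = ?H +>\<^bsub>N\<^esub> proj q"
      unfolding coset[OF p] coset[OF q] image_image .
  qed
  show "(?H +>\<^bsub>N\<^esub> proj p) \<oplus>\<^bsub>quotient_module N ?H\<^esub> (?H +>\<^bsub>N\<^esub> proj q) = ?H +>\<^bsub>N\<^esub> proj (p + q)"
    if p: "p \<in> span_of B" and q: "q \<in> span_of B" for p q
  proof -
    have pq: "p + q \<in> span_of B" using p q by (rule span_of_add)
    have "proj (c + p) \<oplus> proj (d + q) = proj ((c + d) + (p + q))"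
      if "c \<in> span_of C" "d \<in> span_of C" for c d
      using that p q CB by (simp add: proj_add span_of_add add_ac)
    then have "(?H +>\<^bsub>N\<^esub> proj p) <+>\<^bsub>N\<^esub> (?H +>\<^bsub>N\<^esub> proj q) =
        (\<Union>c\<in>span_of C. \<Union>d\<in>span_of C. {proj ((c + d) + (p + q))})"
      unfolding coset[OF p] coset[OF q] set_add_def' by (auto simp: UN_extend_simps)
    also have "\<dots> = (\<lambda>c. proj (c + (p + q))) ` span_of C"
    proof (intro Set.set_eqI iffI)
      fix x assume "x \<in> (\<Union>c\<in>span_of C. \<Union>d\<in>span_of C. {proj ((c + d) + (p + q))})"
      then show "x \<in> (\<lambda>c. proj (c + (p + q))) ` span_of C" using span_of_add by blast
    next
      fix x assume "x \<in> (\<lambda>c. proj (c + (p + q))) ` span_of C"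
      then obtain c where "c \<in> span_of C" "x = proj ((c + 0) + (p + q))" by auto
      then show "x \<in> (\<Union>c\<in>span_of C. \<Union>d\<in>span_of C. {proj ((c + d) + (p + q))})"
        using span_of_0 by blast
    qed
    finally show ?thesis using coset[OF pq] by (simp add: quotient_module_def)
  qed
  show "s \<odot>\<^bsub>quotient_module N ?H\<^esub> (?H +>\<^bsub>N\<^esub> proj p) = ?H +>\<^bsub>N\<^esub> proj (s * p)"
    if p: "p \<in> span_of B" for s p
  proof -
    have "?H +>\<^bsub>N\<^esub> (s \<odot> proj (c + p)) = ?H +>\<^bsub>N\<^esub> proj (s * p)" if c: "c \<in> span_of C" for c
    proof -
      have "s * (c + p) - s * p \<in> span_of C"
        using span_of_smult[OF assms(1) c, of s] by (simp add: algebra_simps)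
      then show ?thesis
        using p c CB iff[of "s * (c + p)" "s * p"]
        by (simp add: proj_smult span_of_add span_of_smult[OF up_closed_B])
    qed
    moreover have "(0 :: ('n, 'k) mpoly) \<in> span_of C" by simp
    ultimately have "(\<Union>c\<in>span_of C. ?H +>\<^bsub>N\<^esub> (s \<odot> proj (c + p))) = ?H +>\<^bsub>N\<^esub> proj (s * p)" by blast
    then show ?thesis unfolding quotient_module_def quotient_smult_def coset[OF p] by simp
  qed
qed (use assms up_closed_B in auto)

lemma image_span_submodule:
  assumes "up_closed C" "C \<subseteq> B"
  shows "submodule (proj ` span_of C) mpoly_ring N"
proof (rule submoduleI)
  have CB: "c \<in> span_of B" if "c \<in> span_of C" for c :: "('n, 'k) mpoly"
    using that span_of_mono[OF assms(2)] by blast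
  show "proj ` span_of C \<subseteq> carrier N" using CB by auto
  show "\<zero> \<in> proj ` span_of C" by (simp add: zero_eq)
  show "\<ominus> x \<in> proj ` span_of C" if "x \<in> proj ` span_of C" for x
    using that CB by (auto simp: minus_proj intro!: imageI span_of_uminus)
  show "x \<oplus> y \<in> proj ` span_of C" if "x \<in> proj ` span_of C" "y \<in> proj ` span_of C" for x y
    using that CB by (auto simp: proj_add intro!: imageI span_of_add)
  show "s \<odot> x \<in> proj ` span_of C" if x: "x \<in> proj ` span_of C" for s x
  proof -
    obtain p where "p \<in> span_of C" "x = proj p" using x by blast
    then have "s \<odot> x = proj (s * p)" "s * p \<in> span_of C"
      using CB assms(1) by (auto simp: proj_smult span_of_smult)
    then show ?thesis by blast
  qed
qed

lemma image_span_multigraded_submodule: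
  assumes "up_closed C" "A \<subseteq> C" "C \<subseteq> B"
  shows "multigraded_submodule (proj ` span_of C) N"
  unfolding multigraded_submodule_def
  using image_span_submodule[OF assms(1,3)] monomial_subquotient.multigraded[OF restrict[OF assms]]
  by blast

text \<open>
  Decompose an element of \<open>L\<close> into homogeneous elements of \<open>L\<close>.  Each of these is represented by
  a scalar multiple of a single monomial, so every monomial of a representing polynomial that is
  not in \<open>A\<close> represents an element of \<open>L\<close> as well.
\<close>

lemma multigraded_submodule_is_image_span:
  assumes "multigraded_submodule L N"
  shows "\<exists>C. up_closed C \<and> A \<subseteq> C \<and> C \<subseteq> B \<and> L = proj ` span_of C"
proof -
  have sub: "submodule L mpoly_ring N" and "multigraded_module (restrict_module N L)"
    using assms by (auto simp: multigraded_submodule_def)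
  interpret R: multigraded_module "restrict_module N L" by fact
  have L: "L \<subseteq> carrier N" "\<And>x y. x \<in> L \<Longrightarrow> y \<in> L \<Longrightarrow> x \<oplus> y \<in> L"
    "\<And>s x. x \<in> L \<Longrightarrow> s \<odot> x \<in> L" and ne: "L \<noteq> {}"
    using submoduleE[OF sub] by auto
  have L0: "\<zero> \<in> L"
  proof -
    obtain x where "x \<in> L" using ne by blast
    then show ?thesis using L(1) L(3)[of x 0] smult_l_null[of x] by auto
  qed
  define C where "C = {w \<in> B. proj (mono_of w) \<in> L}"
  have "A \<subseteq> C"
  proof
    fix w assume "w \<in> A"
    then have "w \<in> B" "proj (mono_of w) = \<zero>" using A_le_B by (auto simp: proj_eq_zero_iff)
    then show "w \<in> C" using L0 by (simp add: C_def)
  qed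
  moreover have "up_closed C"
    unfolding up_closed_def
  proof safe
    fix w z assume w: "w \<in> C" "w \<le> z"
    have "z = (\<lambda>i. (z i - w i) + w i)" using w(2) by (auto simp: le_fun_def)
    then have "mono_of z = mono_of (\<lambda>i. z i - w i) * (mono_of w :: ('n, 'k) mpoly)"
      by (simp add: mono_of_mult)
    then have "proj (mono_of z) = mono_of (\<lambda>i. z i - w i) \<odot> proj (mono_of w)"
      using w(1) by (simp add: C_def proj_smult)
    then show "z \<in> C" using w L(3) up_closedD[OF up_closed_B] by (auto simp: C_def)
  qed
  moreover have "proj ` span_of C \<subseteq> L"
  proof safe
    fix p :: "('n, 'k) mpoly" assume "p \<in> span_of C"
    then have "p \<in> span_of B \<and> proj p \<in> L"
    proof (induction rule: span_of_induct)
      case zero show ?case using L0 by (simp add: zero_eq)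
    next
      case (add p q)
      then show ?case using L(2)[of "proj p" "proj q"] by (simp add: proj_add span_of_add)
    next
      case (single w c)
      then have "mono_of w \<in> (span_of B :: ('n, 'k) mpoly set)" "proj (mono_of w) \<in> L"
        by (auto simp: C_def)
      then show ?case
        using L(3)[of "proj (mono_of w)" "Poly_Mapping.single 0 c"]
        by (simp add: single_eq_mult_mono_of proj_smult span_of_smult[OF up_closed_B])
    qed
    then show "proj p \<in> L" by blast
  qed
  moreover have "L \<subseteq> proj ` span_of C"
  proof
    fix x assume x: "x \<in> L"
    then obtain p where p: "p \<in> span_of B" "x = proj p" using L(1) by (auto simp: carrier_eq)
    have "x \<in> carrier (restrict_module N L)" using x by (simp add: restrict_module_def)
    from R.direct_sum[OF this] obtain f where f: "\<And>a. f a \<in> component N a" "\<And>a. f a \<in> L"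
      "finite {a. f a \<noteq> \<zero>}" "x = finsum (restrict_module N L) f {a. f a \<noteq> \<zero>}"
      by (auto simp: restrict_module_def)
    let ?T = "{a. f a \<noteq> \<zero>}"
    have "\<forall>a. \<exists>q. q \<in> span_of (degree_set a \<inter> B) \<and> f a = proj q"
      using f(1) unfolding component_eq by blast
    then obtain q where q: "\<And>a. q a \<in> span_of (degree_set a \<inter> B)" "\<And>a. f a = proj (q a)" by metis
    then have qB: "q a \<in> span_of B" and qd: "q a \<in> span_of (degree_set a)" for a
      by (auto simp: span_of_Int)
    have "x = proj (sum q ?T)"
      unfolding f(4) unfolding q(2)
      using f(2,3) qB by (intro finsum_proj[OF R.abelian_monoid_axioms]) (auto simp: restrict_module_def q(2))
    then have diff: "p - sum q ?T \<in> span_of A"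
      using p qB proj_eq_iff span_of_sum by metis
    have "p \<in> span_of C"
      unfolding span_of_iff
    proof (intro allI impI)
      fix w assume w: "w \<notin> C"
      let ?a = "\<lambda>i. int (w i)"
      show "Poly_Mapping.lookup p (expo w) = 0"
      proof (rule ccontr)
        assume nz: "Poly_Mapping.lookup p (expo w) \<noteq> 0"
        have wB: "w \<in> B" using nz p(1) unfolding span_of_iff by blast
        have "w \<notin> A" using w \<open>A \<subseteq> C\<close> by blast
        then have "Poly_Mapping.lookup (p - sum q ?T) (expo w) = 0"
          using diff unfolding span_of_iff by blast
        then have "Poly_Mapping.lookup p (expo w) =
            (if ?a \<in> ?T then Poly_Mapping.lookup (q ?a) (expo w) else 0)"
          using lookup_homogeneous_sum[OF f(3) qd, of w] by (simp add: lookup_minus)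
        then obtain c where c: "c \<noteq> 0" "Poly_Mapping.lookup (q ?a) (expo w) = c"
          using nz by (auto split: if_splits)
        have "q ?a = Poly_Mapping.single (expo w) c"
          using homogeneous_is_single[OF qd degree_set_self] c(2) by metis
        then have "mono_of w = Poly_Mapping.single 0 (1 / c) * q ?a"
          using c(1) by (simp add: mono_of_def mult_single)
        then have "proj (mono_of w) = Poly_Mapping.single 0 (1 / c) \<odot> f ?a"
          using qB q(2) by (simp add: proj_smult)
        then show False using f(2) L(3) w wB by (auto simp: C_def)
      qed
    qed
    then show "x \<in> proj ` span_of C" using p by blast
  qed
  ultimately show ?thesis by (intro exI[of _ C]) (auto simp: C_def)
qed

end

lemma monomial_subquotient_poly_module:
  "monomial_subquotient (poly_module :: (('n::finite, 'k::field) mpoly, _, 'n) mgmodule) (\<lambda>p. p) UNIV {}"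
  by unfold_locales
    (auto simp: up_closed_def span_of_empty component_poly_module, auto simp: poly_module_def)

lemma monomial_subquotient_residue_ring:
  assumes "up_closed A"
  shows "monomial_subquotient
    (quotient_module (poly_module :: (('n::finite, 'k::field) mpoly, _, 'n) mgmodule) (span_of A))
    (\<lambda>p. span_of A +>\<^bsub>poly_module\<^esub> p) UNIV A"
  using monomial_subquotient.quotient[OF monomial_subquotient_poly_module, of A] assms by simp

lemma multigraded_prime_iff:
  "multigraded_prime (P :: ('n::finite, 'k::field) mpoly set) \<longleftrightarrow> (\<exists>F. P = span_of (supported_in F))"
proof
  interpret S: monomial_subquotient "poly_module :: (('n, 'k) mpoly, _, 'n) mgmodule" "\<lambda>p. p" UNIV "{}"
    by (rule monomial_subquotient_poly_module)
  assume P: "multigraded_prime P"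
  then obtain U where "up_closed U" "P = span_of U"
    using S.multigraded_submodule_is_image_span by (auto simp: multigraded_prime_def)
  then show "\<exists>F. P = span_of (supported_in F)"
    using P prime_span_of_is_supported_in by (auto simp: multigraded_prime_def)
next
  interpret S: monomial_subquotient "poly_module :: (('n, 'k) mpoly, _, 'n) mgmodule" "\<lambda>p. p" UNIV "{}"
    by (rule monomial_subquotient_poly_module)
  assume "\<exists>F. P = span_of (supported_in F)"
  then show "multigraded_prime P"
    using primeideal_span_supported_in S.image_span_multigraded_submodule[OF up_closed_supported_in]
    by (auto simp: multigraded_prime_def)
qed

abbreviation residue_module ::
  "('n \<Rightarrow> nat) set \<Rightarrow> (('n::finite, 'k::field) mpoly, ('n, 'k) mpoly set, 'n) mgmodule"
  where "residue_module A \<equiv> quotient_module poly_module (span_of A)"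

abbreviation residue_class ::
  "('n \<Rightarrow> nat) set \<Rightarrow> ('n::finite, 'k::field) mpoly \<Rightarrow> ('n, 'k) mpoly set"
  where "residue_class A p \<equiv> span_of A +>\<^bsub>poly_module\<^esub> p"

lemma shift_module_simps [simp]:
  "carrier (shift_module M a) = carrier M" "add (shift_module M a) = add M"
  "ring.zero (shift_module M a) = ring.zero M"
  "module.smult (shift_module M a) = module.smult M"
  "component (shift_module M a) b = component M (\<lambda>i. a i + b i)"
  by (simp_all add: shift_module_def)

text \<open>
  If \<open>B\<close> arises from \<open>A\<close> by adding the cell of \<open>w\<close> and \<open>F\<close>, the annihilator of the class of the
  monomial \<open>w\<close> is the prime of \<open>F\<close>.
\<close>

lemma cell_step_colon:
  assumes "up_closed B" "B = A \<union> cell w F" "cell w F \<inter> A = {}"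
  shows "(\<lambda>i. w i + e i) \<in> A \<longleftrightarrow> e \<in> supported_in F"
proof -
  have "w \<in> B" using assms(2) base_in_cell by blast
  then have "(\<lambda>i. w i + e i) \<in> B" using assms(1) by (elim up_closedD) (auto simp: le_fun_def)
  moreover have "(\<lambda>i. w i + e i) \<in> cell w F \<longleftrightarrow> e \<notin> supported_in F"
    by (auto simp: cell_def supported_in_def le_fun_def)
  ultimately show ?thesis using assms(2,3) by blast
qed

context monomial_subquotient
begin

text \<open>
  Multiplication by the monomial \<open>w\<close> maps \<open>S\<close> onto the subquotient, with kernel the prime of \<open>F\<close>;
  the isomorphism \<open>f\<close> is the inverse of the induced map.
\<close>

lemma cell_isomorphic:
  assumes "B = A \<union> cell w F" "cell w F \<inter> A = {}"
  shows "multigraded_isomorphic N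
    (shift_module (residue_module (supported_in F)) (\<lambda>j. - int (w j)))"
proof -
  let ?R = "residue_module (supported_in F) :: (('n, 'k) mpoly, ('n, 'k) mpoly set, 'n) mgmodule"
  let ?\<theta> = "residue_class (supported_in F) :: ('n, 'k) mpoly \<Rightarrow> ('n, 'k) mpoly set"
  interpret R: monomial_subquotient ?R ?\<theta> UNIV "supported_in F"
    by (rule monomial_subquotient_residue_ring[OF up_closed_supported_in])
  let ?x = "mono_of w :: ('n, 'k) mpoly"
  have wB: "w \<in> B" using assms(1) base_in_cell by blast
  have xB: "?x * r \<in> span_of B" for r
    using span_of_smult[OF up_closed_B, of ?x r] wB by (simp add: mult.commute)
  have kernel: "?x * r \<in> span_of A \<longleftrightarrow> r \<in> span_of (supported_in F)" for r
    by (simp add: mono_of_mult_in_span_of cell_step_colon[OF up_closed_B assms])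
  have same: "proj (?x * r) = proj (?x * r') \<longleftrightarrow> ?\<theta> r = ?\<theta> r'" for r r'
  proof -
    have "proj (?x * r) = proj (?x * r') \<longleftrightarrow> ?x * (r - r') \<in> span_of A"
      using proj_eq_iff[OF xB xB] by (simp add: right_diff_distrib)
    then show ?thesis using R.proj_eq_iff[of r r'] kernel by simp
  qed
  have cover: "\<exists>r. r \<in> span_of {e. (\<lambda>i. w i + e i) \<in> D} \<and> proj p = proj (?x * r)"
    if p: "p \<in> span_of (D \<inter> B)" for p D
  proof -
    define q where "q = p - part A p"
    have q: "q \<in> span_of (D \<inter> B - A)" unfolding q_def using p by (rule diff_part_in_span_of)
    have "D \<inter> B - A \<subseteq> {w..}" using assms(1) by (auto simp: cell_def)
    then obtain r where r: "q = ?x * r" using q span_of_mono mono_of_dvd by blast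
    have "q \<in> span_of D" using q span_of_mono[of "D \<inter> B - A" D] by blast
    then have "r \<in> span_of {e. (\<lambda>i. w i + e i) \<in> D}" by (simp add: r mono_of_mult_in_span_of)
    moreover have "p - q \<in> span_of A"
      using part_in_span_of[OF p, of A] span_of_mono[of "A \<inter> (D \<inter> B)" A] by (auto simp: q_def)
    then have "proj p = proj (?x * r)"
      using p xB[of r] proj_eq_iff[of p q] by (simp add: r span_of_Int)
    ultimately show ?thesis by blast
  qed
  define f where "f y = ?\<theta> (SOME r. y = proj (?x * r))" for y
  have f: "f (proj (?x * r)) = ?\<theta> r" for r
  proof -
    have "proj (?x * r) = proj (?x * (SOME s. proj (?x * r) = proj (?x * s)))" by (rule someI) simp
    then show ?thesis unfolding f_def using same by metis
  qed
  have rep: "\<exists>r. y = proj (?x * r)" if y: "y \<in> carrier N" for y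
  proof -
    obtain p where "p \<in> span_of B" "y = proj p" using y by (auto simp: carrier_eq)
    then show ?thesis using cover[of p UNIV] by auto
  qed
  have "f \<in> linear_maps mpoly_ring N (shift_module ?R (\<lambda>j. - int (w j)))"
    unfolding linear_maps_def
  proof (intro CollectI conjI ballI funcsetI)
    fix y assume "y \<in> carrier N"
    then obtain r where y: "y = proj (?x * r)" using rep by blast
    show "f y \<in> carrier (shift_module ?R (\<lambda>j. - int (w j)))"
      by (simp add: y f)
    fix s
    have "s \<odot> y = proj (?x * (s * r))" using xB[of r] by (simp add: y proj_smult mult.left_commute)
    then show "f (s \<odot> y) = s \<odot>\<^bsub>shift_module ?R (\<lambda>j. - int (w j))\<^esub> f y"
      by (simp add: y f R.proj_smult)
  next
    fix y z assume "y \<in> carrier N" "z \<in> carrier N"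
    then obtain r s where y: "y = proj (?x * r)" "z = proj (?x * s)" using rep by metis
    have "y \<oplus> z = proj (?x * (r + s))" using xB by (simp add: y proj_add distrib_left)
    then show "f (y \<oplus> z) = f y \<oplus>\<^bsub>shift_module ?R (\<lambda>j. - int (w j))\<^esub> f z"
      by (simp add: y f R.proj_add)
  qed
  moreover have "bij_betw f (carrier N) (carrier (shift_module ?R (\<lambda>j. - int (w j))))"
    unfolding bij_betw_def
  proof
    show "inj_on f (carrier N)"
    proof (rule inj_onI)
      fix y z assume "y \<in> carrier N" "z \<in> carrier N" and fyz: "f y = f z"
      then obtain r s where y: "y = proj (?x * r)" "z = proj (?x * s)" using rep by metis
      then show "y = z" using fyz same[of r s] by (simp add: f)
    qed
    show "f ` carrier N = carrier (shift_module ?R (\<lambda>j. - int (w j)))"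
    proof (intro Set.set_eqI iffI)
      fix z assume "z \<in> f ` carrier N"
      then obtain r where "z = f (proj (?x * r))" using rep by blast
      then show "z \<in> carrier (shift_module ?R (\<lambda>j. - int (w j)))" by (simp add: f)
    next
      fix z assume "z \<in> carrier (shift_module ?R (\<lambda>j. - int (w j)))"
      then obtain r where "z = ?\<theta> r" by (auto simp: R.carrier_eq)
      then have "z = f (proj (?x * r))" by (simp add: f)
      then show "z \<in> f ` carrier N" using xB by blast
    qed
  qed
  moreover have "f ` component N a = component (shift_module ?R (\<lambda>j. - int (w j))) a" for a
  proof -
    have shift: "{e. (\<lambda>i. w i + e i) \<in> degree_set a} = degree_set (\<lambda>i. - int (w i) + a i)"
      by (auto simp: degree_set_def algebra_simps)
    have colon: "?x * r \<in> span_of (degree_set a) \<longleftrightarrow> r \<in> span_of (degree_set (\<lambda>i. - int (w i) + a i))"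
      for r by (simp add: mono_of_mult_in_span_of shift)
    have "f ` proj ` span_of (degree_set a \<inter> B) = ?\<theta> ` span_of (degree_set (\<lambda>i. - int (w i) + a i))"
    proof (intro Set.set_eqI iffI)
      fix z assume "z \<in> f ` proj ` span_of (degree_set a \<inter> B)"
      then obtain p where p: "p \<in> span_of (degree_set a \<inter> B)" "z = f (proj p)" by blast
      then show "z \<in> ?\<theta> ` span_of (degree_set (\<lambda>i. - int (w i) + a i))"
        using cover[OF p(1)] f unfolding shift by force
    next
      fix z assume "z \<in> ?\<theta> ` span_of (degree_set (\<lambda>i. - int (w i) + a i))"
      then obtain r where r: "r \<in> span_of (degree_set (\<lambda>i. - int (w i) + a i))" "z = ?\<theta> r" by blast
      then have "?x * r \<in> span_of (degree_set a \<inter> B)" using colon xB by (simp add: span_of_Int)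
      moreover have "z = f (proj (?x * r))" using r f by simp
      ultimately show "z \<in> f ` proj ` span_of (degree_set a \<inter> B)" by blast
    qed
    then show ?thesis by (simp add: component_eq R.component_eq)
  qed
  ultimately show ?thesis unfolding multigraded_isomorphic_def by blast
qed

text \<open>
  The generator \<open>1\<close> of \<open>S/P(-a)\<close> comes from a homogeneous element of degree \<open>a\<close>, that is, from a
  multiple \<open>q\<close> of a single monomial \<open>w\<close>.  Its annihilator \<open>P\<close> determines which multiples of \<open>w\<close>
  lie in \<open>A\<close>, and since it generates, every exponent in \<open>B\<close> outside \<open>A\<close> is a multiple of \<open>w\<close>.
\<close>

lemma isomorphic_imp_cell:
  assumes "multigraded_isomorphic N (shift_module (residue_module (supported_in F)) (\<lambda>j. - a j))"
  shows "\<exists>w. B = A \<union> cell w F \<and> cell w F \<inter> A = {}"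
proof -
  let ?R = "residue_module (supported_in F) :: (('n, 'k) mpoly, ('n, 'k) mpoly set, 'n) mgmodule"
  let ?\<theta> = "residue_class (supported_in F) :: ('n, 'k) mpoly \<Rightarrow> ('n, 'k) mpoly set"
  interpret R: monomial_subquotient ?R ?\<theta> UNIV "supported_in F"
    by (rule monomial_subquotient_residue_ring[OF up_closed_supported_in])
  obtain f where lin: "f \<in> linear_maps mpoly_ring N (shift_module ?R (\<lambda>j. - a j))"
    and bij: "bij_betw f (carrier N) (carrier ?R)"
    and comp: "\<And>b. f ` component N b = component ?R (\<lambda>i. - a i + b i)"
    using assms unfolding multigraded_isomorphic_def by auto
  have f_smult: "f (s \<odot> y) = s \<odot>\<^bsub>?R\<^esub> f y" if "y \<in> carrier N" for s y
    using lin that by (auto simp: linear_maps_def)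
  have "mono_of (\<lambda>_. 0) \<in> (span_of (degree_set (\<lambda>i. - a i + a i)) :: ('n, 'k) mpoly set)"
    unfolding mono_of_in_span_of by (simp add: degree_set_def)
  then have "?\<theta> 1 \<in> f ` component N a" by (auto simp: comp R.component_eq mono_of_zero)
  then obtain q where q: "q \<in> span_of (degree_set a \<inter> B)" "f (proj q) = ?\<theta> 1"
    by (auto simp: component_eq)
  then have qB: "q \<in> span_of B" and qd: "q \<in> span_of (degree_set a)" by (auto simp: span_of_Int)
  have sqB: "s * q \<in> span_of B" for s using span_of_smult[OF up_closed_B qB] .
  have fq: "f (proj (s * q)) = ?\<theta> s" for s
    using f_smult[of "proj q" s] qB q(2) by (simp add: proj_smult R.proj_smult)
  have inj: "y = z" if "y \<in> carrier N" "z \<in> carrier N" "f y = f z" for y z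
    using bij that by (auto simp: bij_betw_def inj_on_def)
  have kernel: "s * q \<in> span_of A \<longleftrightarrow> s \<in> span_of (supported_in F)" for s
  proof -
    have "s * q \<in> span_of A \<longleftrightarrow> proj (s * q) = proj (0 * q)"
      using proj_eq_iff[OF sqB[of s] sqB[of 0]] by simp
    also have "\<dots> \<longleftrightarrow> ?\<theta> s = ?\<theta> 0" using inj fq sqB by (metis proj_closed)
    finally show ?thesis using R.proj_eq_iff[of s 0] by simp
  qed
  have "mono_of (\<lambda>_. 0) \<notin> (span_of (supported_in F) :: ('n, 'k) mpoly set)"
    unfolding mono_of_in_span_of by (simp add: supported_in_def)
  then have "q \<notin> span_of A" using kernel[of 1] by (simp add: mono_of_zero)
  then obtain w where w: "w \<notin> A" "Poly_Mapping.lookup q (expo w) \<noteq> 0" unfolding span_of_iff by blast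
  define c where "c = Poly_Mapping.lookup q (expo w)"
  have wB: "w \<in> B" and wa: "w \<in> degree_set a" using w(2) qB qd unfolding span_of_iff by blast+
  have q_eq: "q = Poly_Mapping.single (expo w) c"
    unfolding c_def using qd wa by (rule homogeneous_is_single)
  have c0: "c \<noteq> 0" using w by (simp add: c_def)
  have colon: "(\<lambda>i. w i + e i) \<in> A \<longleftrightarrow> e \<in> supported_in F" for e
  proof -
    have "mono_of e * q \<in> span_of A \<longleftrightarrow> (\<lambda>i. w i + e i) \<in> A"
      using single_mult_in_span_of[OF c0, of w "mono_of e" A] by (simp add: q_eq mult.commute)
    then show ?thesis using kernel[of "mono_of e"] by simp
  qed
  have cell_iff: "(\<lambda>i. w i + e i) \<in> cell w F \<longleftrightarrow> (\<lambda>i. w i + e i) \<notin> A" for e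
    unfolding colon by (auto simp: cell_def supported_in_def le_fun_def)
  have shift: "z = (\<lambda>i. w i + (z i - w i))" if "w \<le> z" for z
    using that by (auto simp: le_fun_def)
  have cell: "z \<in> cell w F \<longleftrightarrow> z \<notin> A" if "w \<le> z" for z
    using cell_iff[of "\<lambda>i. z i - w i"] shift[OF that] by simp
  have "z \<in> cell w F" if z: "z \<in> B" "z \<notin> A" for z
  proof -
    have "f (proj (mono_of z)) \<in> carrier ?R" using z(1) bij by (auto simp: bij_betw_def)
    then obtain s where "f (proj (mono_of z)) = ?\<theta> s" by (auto simp: R.carrier_eq)
    then have "proj (mono_of z) = proj (s * q)" using z(1) sqB fq inj by (simp add: carrier_eq)
    then have "mono_of z - s * q \<in> span_of A" using z(1) sqB proj_eq_iff by simp
    then have "Poly_Mapping.lookup (s * q) (expo z) = 1"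
      using z(2) unfolding span_of_iff by (auto simp: mono_of_def lookup_minus)
    then have "expo z \<in> Poly_Mapping.keys (q * s)" by (simp add: in_keys_iff mult.commute)
    then obtain e where "expo z = expo w + e" unfolding q_eq keys_single_mult[OF c0] by blast
    then have "z = (\<lambda>i. w i + Poly_Mapping.lookup e i)" by (metis lookup_expo lookup_add ext)
    then show ?thesis using cell_iff z(2) by simp
  qed
  moreover have "z \<in> B" "z \<notin> A" if z: "z \<in> cell w F" for z
  proof -
    have wz: "w \<le> z" using z by (simp add: cell_def)
    then show "z \<in> B" using up_closedD[OF up_closed_B wB] by blast
    show "z \<notin> A" using cell[OF wz] z by simp
  qed
  ultimately show ?thesis using A_le_B by (intro exI[of _ w]) blast
qed

lemma subquotient:
  assumes "up_closed C" "up_closed D" "A \<subseteq> C" "C \<subseteq> D" "D \<subseteq> B"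
  shows "monomial_subquotient
    (quotient_module (restrict_module N (proj ` span_of D)) (proj ` span_of C))
    (\<lambda>p. proj ` span_of C +>\<^bsub>restrict_module N (proj ` span_of D)\<^esub> proj p) D C"
proof -
  interpret D: monomial_subquotient "restrict_module N (proj ` span_of D)" proj D A
    using restrict assms by blast
  show ?thesis using D.quotient assms by blast
qed

end

section \<open>Pretty clean residue rings\<close>

text \<open>
  The recursive description of filtrations, expressed by the sequence of stages as in the
  definition of prime filtrations.
\<close>

lemma cell_filtration_stages:
  "cell_filtration A c B \<longleftrightarrow> (\<exists>U. U 0 = A \<and> U (length c) = B \<and> (\<forall>k<length c.
    cell (fst (c ! k)) (snd (c ! k)) \<inter> U k = {} \<and>
    U (Suc k) = U k \<union> cell (fst (c ! k)) (snd (c ! k)) \<and> up_closed (U (Suc k))))"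
proof (induction c arbitrary: A)
  case Nil
  show ?case by auto
next
  case (Cons x c)
  obtain w F where x: "x = (w, F)" by fastforce
  let ?P = "\<lambda>c U k. cell (fst (c ! k)) (snd (c ! k)) \<inter> U k = {} \<and>
    U (Suc k) = U k \<union> cell (fst (c ! k)) (snd (c ! k)) \<and> up_closed (U (Suc k))"
  show ?case
  proof
    assume c: "cell_filtration A (x # c) B"
    then have "cell_filtration (A \<union> cell w F) c B" by (simp add: x)
    then obtain U where U: "U 0 = A \<union> cell w F" "U (length c) = B" "\<forall>k<length c. ?P c U k"
      using Cons.IH by blast
    define U' where "U' k = (case k of 0 \<Rightarrow> A | Suc k \<Rightarrow> U k)" for k
    have "?P (x # c) U' k" if "k < length (x # c)" for k
      using that U c by (cases k) (auto simp: U'_def x)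
    then have "\<forall>k<length (x # c). ?P (x # c) U' k" by blast
    moreover have "U' 0 = A" "U' (length (x # c)) = B" using U(2) by (simp_all add: U'_def)
    ultimately show "\<exists>U. U 0 = A \<and> U (length (x # c)) = B \<and> (\<forall>k<length (x # c). ?P (x # c) U k)"
      by (intro exI[of _ U'] conjI)
  next
    assume "\<exists>U. U 0 = A \<and> U (length (x # c)) = B \<and> (\<forall>k<length (x # c). ?P (x # c) U k)"
    then obtain U where U: "U 0 = A" "U (length (x # c)) = B" "\<And>k. k < length (x # c) \<Longrightarrow> ?P (x # c) U k"
      by blast
    have "?P c (\<lambda>k. U (Suc k)) k" if "k < length c" for k
      using U(3)[of "Suc k", unfolded nth_Cons_Suc] that by auto
    moreover have "U (Suc 0) = A \<union> cell w F" using U(1) U(3)[of 0] by (simp add: x)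
    moreover have "U (Suc (length c)) = B" using U(2) by simp
    ultimately have "cell_filtration (A \<union> cell w F) c B"
      unfolding Cons.IH by (intro exI[of _ "\<lambda>k. U (Suc k)"] conjI allI impI) blast+
    then show "cell_filtration A (x # c) B" using U(1) U(3)[of 0] by (auto simp: x)
  qed
qed

lemma span_supported_in_subset_iff:
  "(span_of (supported_in F) :: ('n::finite, 'k::field) mpoly set) \<subseteq> span_of (supported_in G) \<longleftrightarrow> F \<subseteq> G"
  by (simp add: span_of_subset_iff supported_in_subset_iff)

lemma span_supported_in_eq_iff:
  "(span_of (supported_in F) :: ('n::finite, 'k::field) mpoly set) = span_of (supported_in G) \<longleftrightarrow> F = G"
  by (simp add: set_eq_subset span_supported_in_subset_iff)

lemma pretty_iff_nth:
  "pretty c \<longleftrightarrow> (\<forall>i j. i < j \<longrightarrow> j < length c \<longrightarrow> snd (c ! i) \<subseteq> snd (c ! j) \<longrightarrow> snd (c ! i) = snd (c ! j))"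
  by (auto simp: pretty_def sorted_wrt_iff_nth_less)

lemma pretty_clean_residue_module_if:
  fixes A :: "('n::finite \<Rightarrow> nat) set"
  assumes A: "up_closed A" and "cell_pretty_clean A"
  shows "pretty_clean (residue_module A :: (('n, 'k::field) mpoly, ('n, 'k) mpoly set, 'n) mgmodule)"
proof -
  let ?M = "residue_module A :: (('n, 'k) mpoly, ('n, 'k) mpoly set, 'n) mgmodule"
  let ?\<theta> = "residue_class A :: ('n, 'k) mpoly \<Rightarrow> ('n, 'k) mpoly set"
  interpret M: monomial_subquotient ?M ?\<theta> UNIV A
    by (rule monomial_subquotient_residue_ring[OF A])
  obtain c where c: "cell_filtration A c UNIV" "pretty c"
    using assms(2) by (auto simp: cell_pretty_clean_def)
  define r where "r = length c"
  obtain U where U: "U 0 = A" "U r = UNIV"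
    "\<And>k. k < r \<Longrightarrow> cell (fst (c ! k)) (snd (c ! k)) \<inter> U k = {}"
    "\<And>k. k < r \<Longrightarrow> U (Suc k) = U k \<union> cell (fst (c ! k)) (snd (c ! k))"
    "\<And>k. k < r \<Longrightarrow> up_closed (U (Suc k))"
    using c(1) unfolding cell_filtration_stages r_def by blast
  have up: "up_closed (U k)" if "k \<le> r" for k
    using that U(1,5) A by (cases k) auto
  have AU: "A \<subseteq> U k" if "k \<le> r" for k
    using that
  proof (induction k)
    case (Suc k)
    then show ?case using U(4)[of k] by auto
  qed (simp add: U(1))
  define Fl where "Fl k = ?\<theta> ` span_of (U k)" for k
  define P where "P k = (span_of (supported_in (snd (c ! (k - 1)))) :: ('n, 'k) mpoly set)" for k
  define a where "a k j = int (fst (c ! (k - 1)) j)" for k j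
  have "prime_filtration ?M r Fl P a"
    unfolding prime_filtration_def
  proof (intro conjI ballI)
    show "Fl 0 = {\<zero>\<^bsub>?M\<^esub>}"
    proof -
      have "?\<theta> p = \<zero>\<^bsub>?M\<^esub>" if "p \<in> span_of A" for p
        using that M.proj_eq_zero_iff[of p] by simp
      moreover have "\<zero>\<^bsub>?M\<^esub> \<in> ?\<theta> ` span_of A" by (simp add: M.zero_eq)
      ultimately show ?thesis unfolding Fl_def U(1) by blast
    qed
    show "Fl r = carrier ?M" by (simp add: Fl_def U(2) M.carrier_eq)
    show "multigraded_submodule (Fl i) ?M" if "i \<in> {0..r}" for i
      unfolding Fl_def using that up AU by (intro M.image_span_multigraded_submodule) auto
    fix i assume "i \<in> {1..r}"
    then obtain k where k: "i = Suc k" "k < r" by (cases i) auto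
    have AUk: "A \<subseteq> U k" "up_closed (U k)" "up_closed (U (Suc k))" "U k \<subseteq> U (Suc k)"
      using k AU[of k] up[of k] up[of "Suc k"] U(4)[of k] by auto
    have "fst (c ! k) \<in> U (Suc k) - U k"
      using U(3,4)[OF k(2)] base_in_cell by blast
    then have "\<not> U (Suc k) \<subseteq> U k" by blast
    then show "Fl (i - 1) \<subset> Fl i"
      using AUk M.image_span_subset_iff[of "U k" "U (Suc k)"] M.image_span_subset_iff[of "U (Suc k)" "U k"]
      by (auto simp: Fl_def k)
    show "multigraded_prime (P i)" unfolding multigraded_prime_iff P_def by blast
    interpret Q: monomial_subquotient "quotient_module (restrict_module ?M (Fl i)) (Fl (i - 1))"
      "\<lambda>p. Fl (i - 1) +>\<^bsub>restrict_module ?M (Fl i)\<^esub> ?\<theta> p" "U i" "U (i - 1)"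
      unfolding Fl_def using AUk by (intro M.subquotient) (auto simp: k)
    show "multigraded_isomorphic (quotient_module (restrict_module ?M (Fl i)) (Fl (i - 1)))
        (shift_module (quotient_module poly_module (P i)) (\<lambda>j. - a i j))"
      unfolding P_def a_def using U(3,4)[OF k(2)] by (intro Q.cell_isomorphic) (auto simp: k)
  qed
  moreover have "P i = P j" if ij: "i \<in> {1..r}" "j \<in> {1..r}" "i < j" "P i \<subseteq> P j" for i j
  proof -
    have "i - 1 < j - 1" "j - 1 < length c" using ij by (auto simp: r_def)
    then show ?thesis
      using c(2) ij(4) unfolding pretty_iff_nth P_def span_supported_in_subset_iff by metis
  qed
  ultimately show ?thesis unfolding pretty_clean_def by blast
qed

lemma cell_pretty_clean_if:
  fixes A :: "('n::finite \<Rightarrow> nat) set"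
  assumes A: "up_closed A"
    and "pretty_clean (residue_module A :: (('n, 'k::field) mpoly, ('n, 'k) mpoly set, 'n) mgmodule)"
  shows "cell_pretty_clean A"
proof -
  let ?M = "residue_module A :: (('n, 'k) mpoly, ('n, 'k) mpoly set, 'n) mgmodule"
  let ?\<theta> = "residue_class A :: ('n, 'k) mpoly \<Rightarrow> ('n, 'k) mpoly set"
  interpret M: monomial_subquotient ?M ?\<theta> UNIV A
    by (rule monomial_subquotient_residue_ring[OF A])
  obtain r Fl P a where filt: "prime_filtration ?M r Fl P a"
    and pretty': "\<forall>i\<in>{1..r}. \<forall>j\<in>{1..r}. i < j \<and> P i \<subseteq> P j \<longrightarrow> P i = P j"
    using assms(2) unfolding pretty_clean_def by (elim exE conjE)
  have pretty: "P i = P j" if "i \<in> {1..r}" "j \<in> {1..r}" "i < j" "P i \<subseteq> P j" for i j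
    using pretty' that by blast
  have F0: "Fl 0 = {\<zero>\<^bsub>?M\<^esub>}" and Fr: "Fl r = carrier ?M"
    and Fsub: "\<And>i. i \<le> r \<Longrightarrow> multigraded_submodule (Fl i) ?M"
    and Fstep: "\<And>i. i \<in> {1..r} \<Longrightarrow> Fl (i - 1) \<subset> Fl i \<and> multigraded_prime (P i) \<and>
      multigraded_isomorphic (quotient_module (restrict_module ?M (Fl i)) (Fl (i - 1)))
        (shift_module (quotient_module poly_module (P i)) (\<lambda>j. - a i j))"
    using filt unfolding prime_filtration_def by auto
  have "\<exists>C. i \<le> r \<longrightarrow> up_closed C \<and> A \<subseteq> C \<and> Fl i = ?\<theta> ` span_of C" for i
  proof (cases "i \<le> r")
    case True
    from M.multigraded_submodule_is_image_span[OF Fsub[OF True]]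
    obtain C where "up_closed C" "A \<subseteq> C" "Fl i = ?\<theta> ` span_of C" by (elim exE conjE)
    then show ?thesis by (intro exI[of _ C] impI conjI)
  qed simp
  then obtain U where U: "\<And>i. i \<le> r \<Longrightarrow> up_closed (U i)" "\<And>i. i \<le> r \<Longrightarrow> A \<subseteq> U i"
    "\<And>i. i \<le> r \<Longrightarrow> Fl i = ?\<theta> ` span_of (U i)" by metis
  have "U 0 \<subseteq> A"
  proof
    fix w assume "w \<in> U 0"
    then have "?\<theta> (mono_of w) \<in> Fl 0" using U(3)[of 0] by simp
    then show "w \<in> A" using F0 M.proj_eq_zero_iff[of "mono_of w"] by simp
  qed
  then have U0: "U 0 = A" using U(2)[of 0] by auto
  have Ur: "U r = UNIV"
  proof -
    have "w \<in> U r" for w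
      using Fr U(3)[of r] M.mem_image_span_iff[of "U r" "mono_of w"] U(2)[of r] by (simp add: M.carrier_eq)
    then show ?thesis by blast
  qed
  have "\<exists>w G. P (Suc k) = span_of (supported_in G) \<and> cell w G \<inter> U k = {} \<and> U (Suc k) = U k \<union> cell w G"
    if k: "k < r" for k
  proof -
    have step: "Fl k \<subset> Fl (Suc k)" "multigraded_prime (P (Suc k))"
      "multigraded_isomorphic (quotient_module (restrict_module ?M (Fl (Suc k))) (Fl k))
        (shift_module (quotient_module poly_module (P (Suc k))) (\<lambda>j. - a (Suc k) j))"
      using Fstep[of "Suc k"] k by auto
    obtain G where G: "P (Suc k) = span_of (supported_in G)"
      using step(2) unfolding multigraded_prime_iff by blast
    have "U k \<subseteq> U (Suc k)"
      using step(1) k U M.image_span_subset_iff[of "U (Suc k)" "U k"] by auto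
    then interpret Q: monomial_subquotient "quotient_module (restrict_module ?M (Fl (Suc k))) (Fl k)"
      "\<lambda>p. Fl k +>\<^bsub>restrict_module ?M (Fl (Suc k))\<^esub> ?\<theta> p" "U (Suc k)" "U k"
      using k U M.subquotient[of "U k" "U (Suc k)"] by simp
    show ?thesis using Q.isomorphic_imp_cell[OF step(3)[unfolded G]] G by blast
  qed
  then obtain w G where wG: "\<And>k. k < r \<Longrightarrow> P (Suc k) = span_of (supported_in (G k))"
    "\<And>k. k < r \<Longrightarrow> cell (w k) (G k) \<inter> U k = {}" "\<And>k. k < r \<Longrightarrow> U (Suc k) = U k \<union> cell (w k) (G k)"
    by metis
  define c where "c = map (\<lambda>k. (w k, G k)) [0..<r]"
  have "up_closed (U k \<union> cell (w k) (G k))" if "k < r" for k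
    using U(1)[of "Suc k"] wG(3)[of k] that by simp
  then have "cell_filtration A c UNIV"
    unfolding cell_filtration_stages
    by (intro exI[of _ U]) (use U0 Ur wG in \<open>auto simp: c_def\<close>)
  moreover have "pretty c"
    unfolding pretty_iff_nth
  proof (intro allI impI)
    fix i j assume ij: "i < j" "j < length c" "snd (c ! i) \<subseteq> snd (c ! j)"
    then have "P (Suc i) \<subseteq> P (Suc j)" by (simp add: c_def wG(1) span_supported_in_subset_iff)
    then have "P (Suc i) = P (Suc j)" using ij by (intro pretty) (auto simp: c_def)
    then show "snd (c ! i) = snd (c ! j)" using ij by (simp add: c_def wG(1) span_supported_in_eq_iff)
  qed
  ultimately show ?thesis unfolding cell_pretty_clean_def by blast
qed

lemma pretty_clean_residue_module_iff:
  fixes A :: "('n::finite \<Rightarrow> nat) set"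
  assumes "up_closed A"
  shows "pretty_clean (residue_module A :: (('n, 'k::field) mpoly, ('n, 'k) mpoly set, 'n) mgmodule)
    \<longleftrightarrow> cell_pretty_clean A"
  using pretty_clean_residue_module_if cell_pretty_clean_if assms by blast

section \<open>Filter-regular sequences\<close>

definition monomial_cone :: "('n::finite, 'k::field) mpoly set \<Rightarrow> ('n \<Rightarrow> nat) set"
  where "monomial_cone T = {z. \<exists>e\<le>z. mono_of e \<in> T}"

lemma up_closed_monomial_cone: "up_closed (monomial_cone T)"
  unfolding up_closed_def monomial_cone_def using order_trans by blast

lemma monomial_cone_insert: "monomial_cone (insert (mono_of e) T) = monomial_cone T \<union> {e..}"
  by (auto simp: monomial_cone_def)

lemma genideal_Un_monomials:
  fixes T :: "('n::finite, 'k::field) mpoly set"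
  assumes "up_closed A" "T \<subseteq> Collect monomial"
  shows "Idl\<^bsub>mpoly_ring\<^esub> (span_of A \<union> T) = span_of (A \<union> monomial_cone T)"
proof (rule genideal_eq_span_of)
  show "up_closed (A \<union> monomial_cone T)" using assms(1) up_closed_monomial_cone by (rule up_closed_Un)
  have "T \<subseteq> span_of (monomial_cone T)"
  proof
    fix u assume "u \<in> T"
    then have "monomial u" using assms(2) by blast
    then obtain w where "u = mono_of w" unfolding monomial_iff by blast
    with \<open>u \<in> T\<close> have "u = mono_of w" "mono_of w \<in> T" by simp_all
    then show "u \<in> span_of (monomial_cone T)" by (auto simp: monomial_cone_def)
  qed
  then show "span_of A \<union> T \<subseteq> span_of (A \<union> monomial_cone T)"
    using span_of_mono[of A "A \<union> monomial_cone T"] span_of_mono[of "monomial_cone T" "A \<union> monomial_cone T"] by blast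
  fix w assume "w \<in> A \<union> monomial_cone T"
  then show "\<exists>v\<le>w. mono_of v \<in> span_of A \<union> T" by (auto simp: monomial_cone_def)
qed

lemma genideal_monomials:
  fixes T :: "('n::finite, 'k::field) mpoly set"
  assumes "T \<subseteq> Collect monomial"
  shows "Idl\<^bsub>mpoly_ring\<^esub> T = span_of (monomial_cone T)"
proof (rule genideal_eq_span_of[OF up_closed_monomial_cone])
  show "T \<subseteq> span_of (monomial_cone T)"
  proof
    fix u assume "u \<in> T"
    then have "monomial u" using assms by blast
    then obtain w where "u = mono_of w" unfolding monomial_iff by blast
    with \<open>u \<in> T\<close> have "u = mono_of w" "mono_of w \<in> T" by simp_all
    then show "u \<in> span_of (monomial_cone T)" by (auto simp: monomial_cone_def)
  qed
qed (auto simp: monomial_cone_def)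

context monomial_subquotient
begin

text \<open>
  The inclusion from right to left splits a polynomial into a part in the kernel and a part in
  the ideal; the latter is hit by acting on the class of \<open>1\<close>.
\<close>

lemma ideal_smult_eq:
  assumes "B = UNIV" "up_closed C"
  shows "ideal_smult mpoly_ring (span_of C) N = proj ` span_of (A \<union> C)"
proof
  have up: "up_closed (A \<union> C)" using up_closed_A assms(2) by (rule up_closed_Un)
  have "s \<odot> x \<in> proj ` span_of (A \<union> C)" if s: "s \<in> span_of C" and x: "x \<in> carrier N" for s x
  proof -
    obtain p where "x = proj p" using x by (auto simp: carrier_eq)
    then have "s \<odot> x = proj (p * s)" using assms(1) by (simp add: proj_smult mult.commute)
    moreover have "p * s \<in> span_of (A \<union> C)"
      using span_of_smult[OF assms(2) s] span_of_mono[of C "A \<union> C"] by blast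
    ultimately show ?thesis by blast
  qed
  then show "ideal_smult mpoly_ring (span_of C) N \<subseteq> proj ` span_of (A \<union> C)"
    unfolding ideal_smult_def using image_span_submodule[OF up] assms(1) by blast
  show "proj ` span_of (A \<union> C) \<subseteq> ideal_smult mpoly_ring (span_of C) N"
    unfolding ideal_smult_def
  proof safe
    fix p :: "('n, 'k) mpoly" and L
    assume p: "p \<in> span_of (A \<union> C)" and L: "submodule L mpoly_ring N"
      "\<forall>s\<in>span_of C. \<forall>x\<in>carrier N. s \<odot> x \<in> L"
    have "p - part A p \<in> span_of C"
      using diff_part_in_span_of[OF p, of A] span_of_mono[of "A \<union> C - A" C] by blast
    then have "(p - part A p) \<odot> proj 1 \<in> L" using L(2) assms(1) by (simp add: carrier_eq)
    then have "proj (p - part A p) \<in> L" using assms(1) by (simp add: proj_smult)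
    moreover have "part A p \<in> span_of A"
      using part_in_span_of[of p UNIV A] by simp
    then have "proj p = proj (p - part A p)" using assms(1) proj_eq_iff[of p "p - part A p"] by simp
    ultimately show "proj p \<in> L" by simp
  qed
qed

text \<open>
  The prime is the annihilator of the class of the monomial \<open>z\<close>.
\<close>

lemma associated_prime_if_colon:
  assumes "z \<in> B" and "\<And>e. (\<lambda>i. z i + e i) \<in> A \<longleftrightarrow> (\<exists>i\<in>F. e i \<noteq> 0)"
  shows "span_of (supported_in F) \<in> associated_primes mpoly_ring N"
  unfolding associated_primes_def
proof (intro CollectI conjI bexI)
  show "primeideal (span_of (supported_in F) :: ('n, 'k) mpoly set) mpoly_ring"
    by (rule primeideal_span_supported_in)
  show "proj (mono_of z) \<in> carrier N" using assms(1) by simp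
  have "s \<odot> proj (mono_of z) = \<zero> \<longleftrightarrow> s \<in> span_of (supported_in F)" for s
  proof -
    have "s * mono_of z \<in> span_of B" using assms(1) by (simp add: span_of_smult[OF up_closed_B])
    then have "s \<odot> proj (mono_of z) = \<zero> \<longleftrightarrow> mono_of z * s \<in> span_of A"
      using assms(1) by (simp add: proj_smult proj_eq_zero_iff mult.commute)
    then show ?thesis by (simp add: mono_of_mult_in_span_of assms(2) supported_in_def)
  qed
  then show "span_of (supported_in F) = annihilator mpoly_ring N (proj (mono_of z))"
    by (auto simp: annihilator_def)
qed

lemma filter_regular_element_avoids:
  assumes "filter_regular_element (mono_of u) N" "z \<in> B" "F \<noteq> UNIV"
    and "\<And>e. (\<lambda>i. z i + e i) \<in> A \<longleftrightarrow> (\<exists>i\<in>F. e i \<noteq> 0)"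
  shows "F \<inter> {i. u i \<noteq> 0} = {}"
proof -
  have "span_of (supported_in F) \<noteq> (max_ideal :: ('n, 'k) mpoly set)"
    unfolding max_ideal_eq span_supported_in_eq_iff by (rule assms(3))
  then have "mono_of u \<notin> (span_of (supported_in F) :: ('n, 'k) mpoly set)"
    using assms(1) associated_prime_if_colon[OF assms(2,4)]
    unfolding filter_regular_element_def by blast
  then show ?thesis by (auto simp: supported_in_def)
qed

lemma filter_regular_element_nonconstant:
  assumes "filter_regular_element (mono_of u) N"
  shows "u \<noteq> (\<lambda>_. 0)"
proof
  assume "u = (\<lambda>_. 0)"
  then have "mono_of u = (1 :: ('n, 'k) mpoly)" by (simp add: mono_of_zero)
  moreover have "(1 :: ('n, 'k) mpoly) \<in> Units mpoly_ring" by (auto simp: Units_def)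
  ultimately show False using assms by (simp add: filter_regular_element_def)
qed

end

text \<open>
  The quotient of \<open>S/I\<close> by the submodule generated by the first \<open>k\<close> monomials is again a monomial
  subquotient, with exponents those of \<open>I\<close> and of these monomials; so the one-step result applies to
  each entry in turn.
\<close>

lemma filter_regular_sequence_residue_module:
  fixes A :: "('n::finite \<Rightarrow> nat) set" and us :: "('n, 'k::field) mpoly list"
  assumes "up_closed A" "filter_regular_sequence us (residue_module A)" "k \<le> length us"
  shows "cell_pretty_clean A \<longleftrightarrow> cell_pretty_clean (A \<union> monomial_cone (set (take k us)))"
  using assms(3)
proof (induction k)
  case 0
  show ?case by (simp add: monomial_cone_def)
next
  case (Suc k)
  let ?M = "residue_module A :: (('n, 'k) mpoly, ('n, 'k) mpoly set, 'n) mgmodule"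
  let ?\<theta> = "residue_class A :: ('n, 'k) mpoly \<Rightarrow> ('n, 'k) mpoly set"
  interpret M: monomial_subquotient ?M ?\<theta> UNIV A
    by (rule monomial_subquotient_residue_ring[OF assms(1)])
  have reg: "filter_regular_element (us ! i) (quotient_module ?M
      (ideal_smult mpoly_ring (Idl\<^bsub>mpoly_ring\<^esub> (set (take i us))) ?M))" if "i < length us" for i
    using assms(2) that by (simp add: filter_regular_sequence_def)
  have monomial: "monomial u" if "u \<in> set us" for u
    using reg that unfolding in_set_conv_nth filter_regular_element_def by blast
  define C where "C = monomial_cone (set (take k us))"
  have "set (take k us) \<subseteq> Collect monomial" using monomial set_take_subset by fastforce
  then have "ideal_smult mpoly_ring (Idl\<^bsub>mpoly_ring\<^esub> (set (take k us))) ?M = ?\<theta> ` span_of (A \<union> C)"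
    using M.ideal_smult_eq[OF refl up_closed_monomial_cone] by (simp add: genideal_monomials C_def)
  moreover obtain u where u: "us ! k = mono_of u"
    using monomial[of "us ! k"] Suc.prems by (auto simp: monomial_iff)
  ultimately have reg: "filter_regular_element (mono_of u) (quotient_module ?M (?\<theta> ` span_of (A \<union> C)))"
    using reg[of k] Suc.prems by simp
  have up: "up_closed (A \<union> C)"
    unfolding C_def using assms(1) up_closed_monomial_cone by (rule up_closed_Un)
  interpret Q: monomial_subquotient "quotient_module ?M (?\<theta> ` span_of (A \<union> C))"
    "\<lambda>p. ?\<theta> ` span_of (A \<union> C) +>\<^bsub>?M\<^esub> ?\<theta> p" UNIV "A \<union> C"
    using up by (intro M.quotient) auto
  have "cell_pretty_clean (A \<union> C) \<longleftrightarrow> cell_pretty_clean (A \<union> C \<union> {u..})"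
    using up Q.filter_regular_element_nonconstant[OF reg] Q.filter_regular_element_avoids[OF reg]
    by (intro cell_pretty_clean_filter_regular) auto
  moreover have "A \<union> monomial_cone (set (take (Suc k) us)) = A \<union> C \<union> {u..}"
    using Suc.prems monomial_cone_insert[of u "set (take k us)"]
    by (auto simp: take_Suc_conv_app_nth u C_def)
  ultimately show ?case using Suc by (simp add: C_def)
qed

theorem theorem3p3:
  fixes I :: "('n::finite, 'k::field) mpoly set"
    and us :: "('n, 'k) mpoly list"
  assumes "monomial_ideal I"
    and "filter_regular_sequence us (quotient_module poly_module I)"
  shows "pretty_clean (quotient_module poly_module I) \<longleftrightarrow>
    pretty_clean (quotient_module poly_module (Idl\<^bsub>mpoly_ring\<^esub> (I \<union> set us)))"
proof -
  obtain T where T: "T \<subseteq> Collect monomial" "I = Idl\<^bsub>mpoly_ring\<^esub> T"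
    using assms(1) by (auto simp: monomial_ideal_def)
  define A where "A = monomial_cone T"
  have I: "I = span_of A" and A: "up_closed A"
    using T genideal_monomials up_closed_monomial_cone by (auto simp: A_def)
  have "set us \<subseteq> Collect monomial"
    using assms(2) by (auto simp: filter_regular_sequence_def filter_regular_element_def in_set_conv_nth)
  then have J: "Idl\<^bsub>mpoly_ring\<^esub> (I \<union> set us) = span_of (A \<union> monomial_cone (set us))"
    unfolding I using A by (intro genideal_Un_monomials)
  have "up_closed (A \<union> monomial_cone (set us))" using A up_closed_monomial_cone by (rule up_closed_Un)
  then show ?thesis
    using filter_regular_sequence_residue_module[OF A assms(2)[unfolded I], of "length us"] A
    unfolding J unfolding I by (simp add: pretty_clean_residue_module_iff)
qed

end
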